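(* Let $\Omega_1,\dots,\Omega_N\subset\mathbb{R}^d$, the boundary functions $\beta_1,\dots,\beta_N$, the function $\Phi$, the kernels $K^*_{i,j}$ and the integral operators $\mathcal{K}^*_{i,j}$ be as defined in the context. Let a query point $\boldsymbol{x}\in\Omega$ and a fixed set of indices $h_0,h_1,\dots,h_i\in\{1,\dots,N\}$ ($i\ge 0$) be given. Let $\{Y_0,Y_1,\dots,Y_i,\dots\}$ be a Markov chain starting from $\boldsymbol{x}$ such that $Y_m\in\partial\Omega_{h_m}$ for each $m$. Let $p_0(\boldsymbol{x},\boldsymbol{y})$ and $p(\boldsymbol{x},\boldsymbol{y})$ be any probability density functions denoting the transitional distribution of $\boldsymbol{y}$ given $\boldsymbol{x}$; that is, $Y_0$ has density $p_0(\boldsymbol{x},\cdot)$ on $\partial\Omega_{h_0}$ and, for $m\ge 1$, given $Y_{m-1}=\boldsymbol{y}$, $Y_m$ has density $p(\boldsymbol{y},\cdot)$ on $\partial\Omega_{h_m}$ (densities with respect to surface measure). Define a family of functions recursively by $$Q^*_{(h_0)}=\frac{\beta_{h_0}(Y_0)}{p_0(\boldsymbol{x},Y_0)},\qquad Q^*_{(h_i,\dots,h_1,h_0)}=Q^*_{(h_{i-1},\dots,h_1,h_0)}\,\frac{K^*_{h_i,h_{i-1}}(Y_i,Y_{i-1})}{p(Y_{i-1},Y_i)}\quad(i\ge 1).$$ Then $Q^*_{(h_i,\dots,h_1,h_0)}\,\Phi(\boldsymbol{x},Y_i)$ is an unbiased estimator for $$\int_{\partial\Omega_{h_i}}\Phi(\boldsymbol{x},\boldsymbol{y})\,\bigl(\mathcal{K}^*_{h_i,h_{i-1}}\cdots\mathcal{K}^*_{h_2,h_1}\mathcal{K}^*_{h_1,h_0}\beta_{h_0}\bigr)(\boldsymbol{y})\,dA_{\boldsymbol{y}},$$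 i.e. $$\int_{\partial\Omega_{h_i}}\Phi(\boldsymbol{x},\boldsymbol{y})\,\bigl(\mathcal{K}^*_{h_i,h_{i-1}}\cdots\mathcal{K}^*_{h_2,h_1}\mathcal{K}^*_{h_1,h_0}\beta_{h_0}\bigr)(\boldsymbol{y})\,dA_{\boldsymbol{y}}=\mathbb{E}\Bigl[Q^*_{(h_i,\dots,h_1,h_0)}\,\Phi(\boldsymbol{x},Y_i)\Bigr]$$ (for $i=0$ the composition of operators is empty and the integrand is $\Phi(\boldsymbol{x},\boldsymbol{y})\beta_{h_0}(\boldsymbol{y})$).
   Context: Let $d\ge 2$ and let $\Omega=\Omega_1\subset\mathbb{R}^d$ be a bounded, simply connected domain with smooth boundary. Let $\Omega_1,\dots,\Omega_N$ be regions contained in $\Omega$ organized as a rooted tree with root $\Omega_1$: each $\Omega_i$ denotes the $i$-th region together with all its descendants, and each $i\ge 2$ has a unique parent index $\mathrm{pa}(i)$, with $\Omega_i\subset\Omega_{\mathrm{pa}(i)}$. The boundaries $\partial\Omega_1,\dots,\partial\Omega_N$ are of class $C^2$ and do not overlap (they are pairwise disjoint); $\boldsymbol{n}(\boldsymbol{x})$ is the unit outward normal at $\boldsymbol{x}\in\partial\Omega_i$ (pointing out of $\Omega_i$), and $dA$ is surface measure. The function $\beta_i:\partial\Omega_i\to\mathbb{R}$ is given by $\beta_1=\frac{2}{\sigma_1}b_1$ and $\beta_i=-\frac{2}{\sigma_{\mathrm{pa}(i)}+\sigma_i}b_i$ for $i\ge2$, where $b_i\in C^{0,1}(\partial\Omega_i)$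 with $\int_{\partial\Omega_i}b_i\,dA=0$, and $\sigma_1,\dots,\sigma_N\ge0$ are constants (with these denominators nonzero). Let $\omega_d=\pi^{d/2}/\Gamma(d/2+1)$ be the volume of the unit ball of $\mathbb{R}^d$ and $$\Phi(\boldsymbol{x},\boldsymbol{y})=\begin{cases}-\frac{1}{2\pi}\ln|\boldsymbol{x}-\boldsymbol{y}|,& d=2,\\ \frac{1}{d(d-2)\omega_d}\,|\boldsymbol{x}-\boldsymbol{y}|^{2-d},& d\ge3.\end{cases}$$ For $\boldsymbol{x}\in\partial\Omega_i$, $\boldsymbol{y}\in\partial\Omega_j$, $\boldsymbol{x}\ne\boldsymbol{y}$, set $$K^*_{i,j}(\boldsymbol{x},\boldsymbol{y})=-\frac{\partial\Phi(\boldsymbol{x},\boldsymbol{y})}{\partial\boldsymbol{n}(\boldsymbol{x})}=\frac{1}{d\,\omega_d}\,\frac{(\boldsymbol{x}-\boldsymbol{y})\cdot\boldsymbol{n}(\boldsymbol{x})}{|\boldsymbol{x}-\boldsymbol{y}|^d},$$ and define the integral operator $$(\mathcal{K}^*_{i,j}f)(\boldsymbol{x})=\int_{\partial\Omega_j}K^*_{i,j}(\boldsymbol{x},\boldsymbol{y})f(\boldsymbol{y})\,dA_{\boldsymbol{y}},\qquad \boldsymbol{x}\in\partial\Omega_i .$$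
   Formalization: The densities are not arbitrary: p_0(x,y) must be nonzero for almost every y with β_{h_0}(y)≠0, and for each y p(y,z) must be nonzero for almost every z where the kernel K*(z,y)≠0; p is jointly measurable. Without the support condition the claim is false. *)

theory Defs
  imports "HOL-Probability.Probability"
begin

section \<open>Surface measure\<close>

text \<open>
  \<open>k\<close>-dimensional Hausdorff measure on the Borel sets, for \<open>k \<ge> 1\<close>, normalised by
  the volume of the \<open>k\<close>-dimensional unit ball so that it is \<open>k\<close>-dimensional area on
  \<open>C\<^sup>1\<close> submanifolds. Boundedness of the covering sets is required because the library
  leaves the diameter of an unbounded set unspecified. The set function below is a metric outer
  measure, hence countably additive on the Borel sets, so \<open>measure_of\<close> does return it.
\<close>

definition hausdorff_pre :: "nat \<Rightarrow> real \<Rightarrow> 'a::metric_space set \<Rightarrow> ennreal" where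
  "hausdorff_pre k \<delta> A =
     (INF U \<in> {U :: nat \<Rightarrow> 'a set. A \<subseteq> (\<Union>i. U i) \<and> (\<forall>i. bounded (U i) \<and> diameter (U i) \<le> \<delta>)}.
        \<Sum>i. ennreal (unit_ball_vol (real k) * (diameter (U i) / 2) ^ k))"

definition hausdorff_measure :: "nat \<Rightarrow> 'a::metric_space measure" where
  "hausdorff_measure k =
     measure_of UNIV (sets borel) (\<lambda>A. SUP \<delta> \<in> {0<..}. hausdorff_pre k \<delta> A)"

definition surface_measure :: "'a::euclidean_space set \<Rightarrow> 'a measure" where
  "surface_measure S = restrict_space (hausdorff_measure (DIM('a) - 1)) S"


section \<open>Regularity of boundaries and the outward normal\<close>

primrec C_k :: "nat \<Rightarrow> ('a::euclidean_space \<Rightarrow> real) \<Rightarrow> bool" where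
  "C_k 0 f \<longleftrightarrow> continuous_on UNIV f"
| "C_k (Suc k) f \<longleftrightarrow>
     (\<exists>g. (\<forall>x. GDERIV f x :> g x) \<and> (\<forall>e\<in>Basis. C_k k (\<lambda>x. g x \<bullet> e)))"

text \<open>
  Near each boundary point \<open>\<Omega>\<close> is, in suitable Cartesian coordinates, the region above the
  graph of a function of class \<open>R\<close>: \<open>x \<bullet> e\<close> is the vertical coordinate and
  \<open>x - (x \<bullet> e) e\<close> stands for the remaining \<open>d - 1\<close> coordinates. Only the values of
  \<open>\<gamma>\<close> on the hyperplane orthogonal to \<open>e\<close> matter.
\<close>

definition boundary_of_class ::
    "(('a::euclidean_space \<Rightarrow> real) \<Rightarrow> bool) \<Rightarrow> 'a set \<Rightarrow> bool" where
  "boundary_of_class R \<Omega> \<longleftrightarrow>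
     (\<forall>x0\<in>frontier \<Omega>. \<exists>r>0. \<exists>e \<gamma>. norm e = 1 \<and> R \<gamma> \<and>
        \<Omega> \<inter> ball x0 r = {x \<in> ball x0 r. \<gamma> (x - (x \<bullet> e) *\<^sub>R e) < x \<bullet> e})"

definition C2_boundary :: "'a::euclidean_space set \<Rightarrow> bool" where
  "C2_boundary \<Omega> \<longleftrightarrow> boundary_of_class (C_k 2) \<Omega>"

definition smooth_boundary :: "'a::euclidean_space set \<Rightarrow> bool" where
  "smooth_boundary \<Omega> \<longleftrightarrow> boundary_of_class (\<lambda>\<gamma>. \<forall>k. C_k k \<gamma>) \<Omega>"

text \<open>
  The unit vector orthogonal to the velocities of all curves in the boundary through \<open>x\<close>
  that points out of \<open>\<Omega>\<close>; it is unique when the boundary is of class \<open>C\<^sup>1\<close>.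
\<close>

definition outward_normal :: "'a::euclidean_space set \<Rightarrow> 'a \<Rightarrow> 'a" where
  "outward_normal \<Omega> x =
     (THE v. norm v = 1 \<and>
        (\<forall>c w. c 0 = x \<and> range c \<subseteq> frontier \<Omega> \<and> (c has_vector_derivative w) (at (0::real))
                 \<longrightarrow> v \<bullet> w = 0) \<and>
        (\<exists>\<epsilon>>0. \<forall>t\<in>{0<..<\<epsilon>}. x + t *\<^sub>R v \<notin> \<Omega> \<and> x - t *\<^sub>R v \<in> \<Omega>))"


section \<open>Fundamental solution, kernels and integral operators\<close>

definition Phi :: "'a::euclidean_space \<Rightarrow> 'a \<Rightarrow> real" where
  "Phi x y =
     (if DIM('a) = 2 then - (1 / (2 * pi)) * ln (norm (x - y))
      else 1 / (real DIM('a) * (real DIM('a) - 2) * unit_ball_vol (real DIM('a)))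
             * norm (x - y) powr (2 - real DIM('a)))"

text \<open>
  The kernel depends on the index \<open>i\<close> through the normal of \<open>\<Omega>\<^sub>i\<close>, and on \<open>j\<close> only
  through the domain of \<open>y\<close>. For fixed \<open>x\<close> the excluded point \<open>y = x\<close> has
  surface measure zero; the formula gives \<open>0\<close> there.
\<close>

definition K_star :: "'a::euclidean_space set \<Rightarrow> 'a \<Rightarrow> 'a \<Rightarrow> real" where
  "K_star \<Omega> x y =
     1 / (real DIM('a) * unit_ball_vol (real DIM('a)))
       * (((x - y) \<bullet> outward_normal \<Omega> x) / norm (x - y) ^ DIM('a))"

lemma K_star_eq_normal_derivative:
  fixes x y :: "'a::euclidean_space"
  assumes d: "DIM('a) \<ge> 2" and xy: "x \<noteq> y"
  shows "((\<lambda>t. Phi (x + t *\<^sub>R outward_normal \<Omega> x) y) has_real_derivative - K_star \<Omega> x y) (at 0)"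
proof -
  let ?d = "DIM('a)" and ?n = "outward_normal \<Omega> x"
  define r where "r t = norm (x + t *\<^sub>R ?n - y)" for t
  define s where "s = ((x - y) \<bullet> ?n) / norm (x - y)"
  have r0: "r 0 = norm (x - y)" and pos: "norm (x - y) > 0"
    using xy by (auto simp: r_def)
  have "((\<lambda>t. x + t *\<^sub>R ?n - y) has_derivative (\<lambda>h. h *\<^sub>R ?n)) (at 0)"
    by (auto intro!: derivative_eq_intros)
  from has_derivative_compose[OF this, of norm "\<lambda>h. h \<bullet> sgn (x - y)"] xy
  have "(r has_derivative (\<lambda>h. (h *\<^sub>R ?n) \<bullet> sgn (x - y))) (at 0)"
    using has_derivative_norm[of "x - y"] by (simp add: r_def[abs_def])
  then have "(r has_derivative (\<lambda>h. s * h)) (at 0)"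
    by (simp add: s_def sgn_div_norm inner_commute divide_inverse mult_ac)
  then have r': "(r has_real_derivative s) (at 0)"
    by (simp add: has_field_derivative_def)
  show ?thesis
  proof (cases "?d = 2")
    case True
    have "unit_ball_vol 2 = pi"
      by (simp add: unit_ball_vol_2)
    moreover have "((\<lambda>t. - (1 / (2 * pi)) * ln (r t)) has_real_derivative
        - (1 / (2 * pi)) * (s / norm (x - y))) (at 0)"
      using r' r0 pos by (auto intro!: derivative_eq_intros)
    ultimately show ?thesis
      using True by (simp add: Phi_def K_star_def r_def s_def power2_eq_square)
  next
    case False
    let ?c = "1 / (real ?d * (real ?d - 2) * unit_ball_vol (real ?d))"
    have d2: "real ?d - 2 \<noteq> 0" using False d by linarith
    have "((\<lambda>t. ?c * r t powr (2 - real ?d)) has_real_derivative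
        ?c * ((2 - real ?d) * norm (x - y) powr (2 - real ?d - 1) * s)) (at 0)"
      using DERIV_fun_powr[OF r', of "2 - real ?d"] r0 pos by (intro DERIV_cmult) simp
    moreover have "norm (x - y) powr (2 - real ?d - 1) = norm (x - y) / norm (x - y) ^ ?d"
      using pos by (simp add: powr_diff powr_realpow power2_eq_square)
    then have "norm (x - y) powr (2 - real ?d - 1) * s = ((x - y) \<bullet> ?n) / norm (x - y) ^ ?d"
      using pos by (simp add: s_def)
    moreover have "1 / (D * e * u) * (- e * P * s) = - (1 / (D * u) * R)"
      if "P * s = R" "e \<noteq> 0" for D e u P R :: real
      using that by (simp flip: that(1))
    from this[OF calculation(2) d2, of "real ?d" "unit_ball_vol (real ?d)"]
    have "?c * ((2 - real ?d) * norm (x - y) powr (2 - real ?d - 1) * s) = - K_star \<Omega> x y"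
      by (simp add: K_star_def)
    ultimately show ?thesis
      using False by (simp add: Phi_def r_def)
  qed
qed

definition K_star_op ::
    "'a::euclidean_space set \<Rightarrow> 'a set \<Rightarrow> ('a \<Rightarrow> real) \<Rightarrow> 'a \<Rightarrow> real" where
  "K_star_op \<Omega>i \<Omega>j f x = (LINT y|surface_measure (frontier \<Omega>j). K_star \<Omega>i x y * f y)"

text \<open>\<open>K_star_iter \<Omega> h f m\<close> is \<open>\<K>\<^sup>*\<^bsub>h m, h (m-1)\<^esub> \<dots> \<K>\<^sup>*\<^bsub>h 1, h 0\<^esub> f\<close>.\<close>

primrec K_star_iter ::
    "(nat \<Rightarrow> 'a::euclidean_space set) \<Rightarrow> (nat \<Rightarrow> nat) \<Rightarrow> ('a \<Rightarrow> real) \<Rightarrow> nat \<Rightarrow> 'a \<Rightarrow> real" where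
  "K_star_iter \<Omega> h f 0 = f"
| "K_star_iter \<Omega> h f (Suc m) = K_star_op (\<Omega> (h (Suc m))) (\<Omega> (h m)) (K_star_iter \<Omega> h f m)"

definition beta_fun ::
    "(nat \<Rightarrow> real) \<Rightarrow> (nat \<Rightarrow> nat) \<Rightarrow> (nat \<Rightarrow> 'a \<Rightarrow> real) \<Rightarrow> nat \<Rightarrow> 'a \<Rightarrow> real" where
  "beta_fun \<sigma> pa b i y =
     (if i = 1 then 2 / \<sigma> 1 * b 1 y else - (2 / (\<sigma> (pa i) + \<sigma> i)) * b i y)"


section \<open>The Markov chain and the estimator\<close>

definition probability_density_on :: "'a::euclidean_space set \<Rightarrow> ('a \<Rightarrow> real) \<Rightarrow> bool" where
  "probability_density_on S f \<longleftrightarrow>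
     f \<in> borel_measurable (surface_measure S) \<and> (\<forall>z\<in>S. 0 \<le> f z) \<and>
     (\<integral>\<^sup>+z. ennreal (f z) \<partial>surface_measure S) = 1"

text \<open>The \<open>\<sigma>\<close>-algebra generated by \<open>Y\<^sub>0, \<dots>, Y\<^sub>m\<close>.\<close>

definition history ::
    "'w measure \<Rightarrow> (nat \<Rightarrow> 'w \<Rightarrow> 'a::topological_space) \<Rightarrow> nat \<Rightarrow> 'w measure" where
  "history M Y m =
     vimage_algebra (space M) (\<lambda>\<omega>. \<lambda>k\<in>{..m}. Y k \<omega>) (\<Pi>\<^sub>M k\<in>{..m}. borel)"

text \<open>
  \<open>Y\<^sub>0, \<dots>, Y\<^sub>n\<close> is a Markov chain with \<open>Y\<^sub>m\<close> in \<open>S m\<close> whose initial density is \<open>q\<close>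
  and whose transition density is \<open>p\<close>: conditionally on the whole past \<open>Y\<^sub>0, \<dots>, Y\<^sub>m\<close>,
  the variable \<open>Y\<^sub>m\<^sub>+\<^sub>1\<close> has density \<open>p (Y\<^sub>m)\<close> with respect to surface measure on \<open>S (m+1)\<close>.
\<close>

definition markov_chain_with_densities ::
    "'w measure \<Rightarrow> (nat \<Rightarrow> 'w \<Rightarrow> 'a::euclidean_space) \<Rightarrow> (nat \<Rightarrow> 'a set) \<Rightarrow> nat \<Rightarrow>
     ('a \<Rightarrow> real) \<Rightarrow> ('a \<Rightarrow> 'a \<Rightarrow> real) \<Rightarrow> bool" where
  "markov_chain_with_densities M Y S n q p \<longleftrightarrow>
     prob_space M \<and>
     (\<forall>m\<le>n. Y m \<in> M \<rightarrow>\<^sub>M surface_measure (S m)) \<and>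
     distributed M (surface_measure (S 0)) (Y 0) (\<lambda>y. ennreal (q y)) \<and>
     (\<forall>m<n. \<forall>A\<in>sets (surface_measure (S (Suc m))). AE \<omega> in M.
        real_cond_exp M (history M Y m) (\<lambda>\<omega>. indicator A (Y (Suc m) \<omega>)) \<omega> =
        (LINT z:A|surface_measure (S (Suc m)). p (Y m \<omega>) z))"

primrec Q_star ::
    "(nat \<Rightarrow> 'a::euclidean_space set) \<Rightarrow> (nat \<Rightarrow> nat) \<Rightarrow> (nat \<Rightarrow> 'a \<Rightarrow> real) \<Rightarrow>
     ('a \<Rightarrow> 'a \<Rightarrow> real) \<Rightarrow> ('a \<Rightarrow> 'a \<Rightarrow> real) \<Rightarrow> 'a \<Rightarrow> (nat \<Rightarrow> 'w \<Rightarrow> 'a) \<Rightarrow> nat \<Rightarrow> 'w \<Rightarrow> real" where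
  "Q_star \<Omega> h \<beta> p0 p x Y 0 \<omega> = \<beta> (h 0) (Y 0 \<omega>) / p0 x (Y 0 \<omega>)"
| "Q_star \<Omega> h \<beta> p0 p x Y (Suc m) \<omega> =
     Q_star \<Omega> h \<beta> p0 p x Y m \<omega> *
       (K_star (\<Omega> (h (Suc m))) (Y (Suc m) \<omega>) (Y m \<omega>) / p (Y m \<omega>) (Y (Suc m) \<omega>))"

definition unbiased_estimator :: "'w measure \<Rightarrow> ('w \<Rightarrow> real) \<Rightarrow> real \<Rightarrow> bool" where
  "unbiased_estimator M X \<theta> \<longleftrightarrow> integrable M X \<and> \<theta> = integral\<^sup>L M X"

end

theory Submission
  imports Defs
begin

text \<open>
  Each step of the chain contributes the factor \<open>K\<^sup>* / p\<close> to the weight, and integrating against the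
  transition density \<open>p\<close> cancels the denominator; so conditioning on \<open>Y\<^sub>0, \<dots>, Y\<^sub>m\<close> turns
  \<open>Q\<^sup>*\<^sub>m\<^sub>+\<^sub>1 G(Y\<^sub>m\<^sub>+\<^sub>1)\<close> into \<open>Q\<^sup>*\<^sub>m G'(Y\<^sub>m)\<close> with \<open>G'(y) = \<integral> K\<^sup>*(z, y) G(z) dA\<^sub>z\<close>, and Fubini's theorem moves the
  kernel over to the iterated operator. For nonnegative integrands this is Tonelli's theorem, which
  reduces integrability to a bound for the iterates of the absolute values of the kernels.

  That bound is potential theory. In a graph chart of a \<open>C\<^sup>2\<close> boundary the outward normal is
  the normalised gradient of \<open>\<gamma>(x - (x \<bullet> e) e) - x \<bullet> e\<close>, and Taylor's formula gives
  \<open>\<bar>(x - y) \<bullet> n(x)\<bar> \<le> C \<bar>x - y\<bar>\<^sup>2\<close>. Hence \<open>K\<^sup>*\<close> and \<open>\<Phi>\<close> are both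
  \<open>O(\<bar>x - y\<bar>\<^sup>1\<^sup>/\<^sup>2\<^sup>-\<^sup>k)\<close> with \<open>k = d - 1\<close>, the exponent \<open>1/2\<close> also absorbing the logarithm for
  \<open>d = 2\<close>. Since the surface measure of a ball of radius \<open>r\<close> is \<open>O(r\<^sup>k)\<close>, summing over dyadic
  shells shows that such a singularity has uniformly bounded integrals.
\<close>

section \<open>Disintegration of a joint law along a conditional density\<close>

section \<open>Conditional densities\<close>

text \<open>Rectangles form an intersection-stable generator that contains the whole space, so a
  constant sequence exhausts the space and only its finite mass under \<open>P\<close> has to be
  known.\<close>

lemma measure_eqI_rectangles:
  assumes P: "finite_measure P" and sP: "sets P = sets (N1 \<Otimes>\<^sub>M N2)"
    and sQ: "sets Q = sets (N1 \<Otimes>\<^sub>M N2)"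
    and eq: "\<And>A B. A \<in> sets N1 \<Longrightarrow> B \<in> sets N2 \<Longrightarrow> emeasure P (A \<times> B) = emeasure Q (A \<times> B)"
  shows "P = Q"
proof (rule measure_eqI_generator_eq[OF Int_stable_pair_measure_generator[of N1 N2]])
  show "{a \<times> b |a b. a \<in> sets N1 \<and> b \<in> sets N2} \<subseteq> Pow (space N1 \<times> space N2)"
    by (rule pair_measure_closed)
  show "emeasure P X = emeasure Q X" if "X \<in> {a \<times> b |a b. a \<in> sets N1 \<and> b \<in> sets N2}" for X
    using that eq by auto
  show "sets P = sigma_sets (space N1 \<times> space N2) {a \<times> b |a b. a \<in> sets N1 \<and> b \<in> sets N2}"
    "sets Q = sigma_sets (space N1 \<times> space N2) {a \<times> b |a b. a \<in> sets N1 \<and> b \<in> sets N2}"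
    using sP sQ by (simp_all add: sets_pair_measure)
  show "range (\<lambda>_::nat. space N1 \<times> space N2) \<subseteq> {a \<times> b |a b. a \<in> sets N1 \<and> b \<in> sets N2}"
    by auto
  show "emeasure P (space N1 \<times> space N2) \<noteq> \<infinity>"
    using P by (simp add: finite_measure.emeasure_finite)
qed auto

text \<open>\<open>X\<close> will be the pair of accumulated weight and current position: the
  density sees only the position, but the weight must belong to the conditioning variable because
  the integrands involve it. \<open>cond\<close> speaks of indicators only; \<open>joint_law\<close>
  extends it to general integrands.\<close>

locale conditional_density = prob_space M for M :: "'w measure" +
  fixes F :: "'w measure" and X :: "'w \<Rightarrow> 'b" and N1 :: "'b measure"
    and Y :: "'w \<Rightarrow> 'c" and N2 :: "'c measure" and p :: "'b \<Rightarrow> 'c \<Rightarrow> real"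
  assumes subalg: "subalgebra M F"
    and X: "X \<in> F \<rightarrow>\<^sub>M N1" and Y[measurable]: "Y \<in> M \<rightarrow>\<^sub>M N2"
    and sf: "sigma_finite_measure N2"
    and p[measurable]: "(\<lambda>(x, z). p x z) \<in> borel_measurable (N1 \<Otimes>\<^sub>M N2)"
    and p_nonneg: "\<And>x z. x \<in> space N1 \<Longrightarrow> z \<in> space N2 \<Longrightarrow> 0 \<le> p x z"
    and p_one: "\<And>x. x \<in> space N1 \<Longrightarrow> (\<integral>\<^sup>+z. ennreal (p x z) \<partial>N2) = 1"
    and cond: "\<And>B. B \<in> sets N2 \<Longrightarrow> AE \<omega> in M.
      real_cond_exp M F (\<lambda>\<omega>. indicator B (Y \<omega>)) \<omega> = (LINT z:B|N2. p (X \<omega>) z)"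
begin

lemma X_M[measurable]: "X \<in> M \<rightarrow>\<^sub>M N1"
  by (rule measurable_from_subalg[OF subalg X])

text \<open>On a rectangle \<open>A \<times> B\<close> the indicator of \<open>A\<close> is
  \<open>F\<close>-measurable through \<open>X\<close>, so it can be pulled into the conditional
  expectation of the indicator of \<open>B\<close>, which \<open>cond\<close> turns into an integral
  of \<open>p\<close>.\<close>

lemma joint_law:
  "distr M (N1 \<Otimes>\<^sub>M N2) (\<lambda>\<omega>. (X \<omega>, Y \<omega>)) =
     density (distr M N1 X \<Otimes>\<^sub>M N2) (\<lambda>(x, z). ennreal (p x z))" (is "?P = ?Q")
proof (rule measure_eqI_rectangles)
  interpret N2: sigma_finite_measure N2 by (rule sf)
  interpret FS: finite_measure_subalgebra M F by unfold_locales (rule subalg)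
  have m: "sets (distr M N1 X \<Otimes>\<^sub>M N2) = sets (N1 \<Otimes>\<^sub>M N2)"
    by (intro sets_pair_measure_cong) auto
  show "finite_measure ?P" by (intro finite_measure_distr) measurable
  show "sets ?P = sets (N1 \<Otimes>\<^sub>M N2)" by simp
  show "sets ?Q = sets (N1 \<Otimes>\<^sub>M N2)" using m by simp
  fix A B assume A[measurable]: "A \<in> sets N1" and B[measurable]: "B \<in> sets N2"
  have pm[measurable]: "p x \<in> borel_measurable N2" if "x \<in> space N1" for x
    using measurable_Pair2[OF p that] by simp
  have intp: "integrable N2 (p x)" if "x \<in> space N1" for x
    by (rule integrableI_nn_integral_finite[where x=1])
       (use that p_nonneg p_one in \<open>auto intro!: AE_I2\<close>)
  \<comment> \<open>The Bochner set integral in \<open>cond\<close> has to match the nonnegative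
    integral that describes \<open>?Q\<close>; integrability of \<open>p x\<close>, from
    \<open>p_one\<close>, makes the two agree.\<close>
  have setp: "(\<integral>\<^sup>+z. ennreal (p x z) * indicator B z \<partial>N2) = ennreal (LINT z:B|N2. p x z)"
    "0 \<le> (LINT z:B|N2. p x z)"
    if "x \<in> space N1" for x
  proof -
    have "integrable N2 (\<lambda>z. indicator B z *\<^sub>R p x z)"
      by (rule integrable_mult_indicator[OF B intp[OF that]])
    from nn_integral_eq_integral[OF this]
    have "(\<integral>\<^sup>+z. ennreal (indicator B z *\<^sub>R p x z) \<partial>N2) = ennreal (LINT z:B|N2. p x z)"
      using p_nonneg[OF that] by (auto simp: set_lebesgue_integral_def intro!: AE_I2)
    moreover have "(\<integral>\<^sup>+z. ennreal (p x z) * indicator B z \<partial>N2)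
        = (\<integral>\<^sup>+z. ennreal (indicator B z *\<^sub>R p x z) \<partial>N2)"
      by (intro nn_integral_cong) (auto split: split_indicator)
    ultimately show "(\<integral>\<^sup>+z. ennreal (p x z) * indicator B z \<partial>N2) = ennreal (LINT z:B|N2. p x z)"
      by simp
    show "0 \<le> (LINT z:B|N2. p x z)" unfolding set_lebesgue_integral_def
      using p_nonneg[OF that] by (intro integral_nonneg_AE) auto
  qed
  have XA: "(\<lambda>\<omega>. indicator A (X \<omega>) :: real) \<in> borel_measurable F"
    using X by measurable
  have YB: "(\<lambda>\<omega>. indicator B (Y \<omega>) :: real) \<in> borel_measurable M" by measurable
  have int: "integrable M (\<lambda>\<omega>. indicator A (X \<omega>) * indicator B (Y \<omega>) :: real)"
    by (rule integrable_const_bound[where B=1]) (auto split: split_indicator)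
  have "emeasure ?P (A \<times> B) = (\<integral>\<^sup>+\<omega>. indicator (A \<times> B) (X \<omega>, Y \<omega>) \<partial>M)"
    by (subst nn_integral_distr[of _ _ "N1 \<Otimes>\<^sub>M N2", symmetric]) auto
  also have "\<dots> = (\<integral>\<^sup>+\<omega>. ennreal (indicator A (X \<omega>) * indicator B (Y \<omega>)) \<partial>M)"
    by (intro nn_integral_cong) (auto split: split_indicator)
  also have "\<dots> = ennreal (\<integral>\<omega>. indicator A (X \<omega>) * indicator B (Y \<omega>) \<partial>M)"
    by (rule nn_integral_eq_integral[OF int]) auto
  also have "(\<integral>\<omega>. indicator A (X \<omega>) * indicator B (Y \<omega>) \<partial>M) =
      (\<integral>\<omega>. indicator A (X \<omega>) * real_cond_exp M F (\<lambda>\<omega>. indicator B (Y \<omega>)) \<omega> \<partial>M)"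
    by (rule FS.real_cond_exp_intg(2)[OF int XA YB, symmetric])
  \<comment> \<open>Nonnegativity of the conditional expectation is available only almost
    everywhere, through \<open>cond\<close>.\<close>
  also have "ennreal \<dots> =
      (\<integral>\<^sup>+\<omega>. ennreal (indicator A (X \<omega>) * real_cond_exp M F (\<lambda>\<omega>. indicator B (Y \<omega>)) \<omega>) \<partial>M)"
    by (rule nn_integral_eq_integral[symmetric, OF FS.real_cond_exp_intg(1)[OF int XA YB]])
       (use cond[OF B] AE_space in \<open>eventually_elim, auto simp: setp(2) measurable_space[OF X_M] intro!: mult_nonneg_nonneg\<close>)
  also have "\<dots> = (\<integral>\<^sup>+\<omega>. indicator A (X \<omega>) * (\<integral>\<^sup>+z. ennreal (p (X \<omega>) z) * indicator B z \<partial>N2) \<partial>M)"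
    by (rule nn_integral_cong_AE)
       (use cond[OF B] AE_space in \<open>eventually_elim, auto simp: setp measurable_space[OF X_M] split: split_indicator\<close>)
  also have "\<dots> = (\<integral>\<^sup>+x. indicator A x * (\<integral>\<^sup>+z. ennreal (p x z) * indicator B z \<partial>N2) \<partial>distr M N1 X)"
    by (subst nn_integral_distr) (use p in measurable)
  also have "\<dots> = (\<integral>\<^sup>+x. (\<integral>\<^sup>+z. ennreal (p x z) * indicator (A \<times> B) (x, z) \<partial>N2) \<partial>distr M N1 X)"
    by (intro nn_integral_cong) (auto simp: indicator_times split: split_indicator)
  also have "\<dots> = (\<integral>\<^sup>+y. (case y of (x, z) \<Rightarrow> ennreal (p x z)) * indicator (A \<times> B) y \<partial>(distr M N1 X \<Otimes>\<^sub>M N2))"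
    by (subst N2.nn_integral_fst[symmetric]) (auto cong: measurable_cong_sets[OF m refl])
  also have "\<dots> = emeasure ?Q (A \<times> B)"
    by (subst emeasure_density) (auto simp: m cong: measurable_cong_sets[OF m refl])
  finally show "emeasure ?P (A \<times> B) = emeasure ?Q (A \<times> B)" .
qed

lemma nn_integral_joint:
  assumes [measurable]: "H \<in> borel_measurable (N1 \<Otimes>\<^sub>M N2)"
  shows "(\<integral>\<^sup>+\<omega>. H (X \<omega>, Y \<omega>) \<partial>M) =
    (\<integral>\<^sup>+\<omega>. (\<integral>\<^sup>+z. ennreal (p (X \<omega>) z) * H (X \<omega>, z) \<partial>N2) \<partial>M)"
proof -
  interpret N2: sigma_finite_measure N2 by (rule sf)
  have m: "sets (distr M N1 X \<Otimes>\<^sub>M N2) = sets (N1 \<Otimes>\<^sub>M N2)"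
    by (intro sets_pair_measure_cong) auto
  have "(\<integral>\<^sup>+\<omega>. H (X \<omega>, Y \<omega>) \<partial>M) = (\<integral>\<^sup>+y. H y \<partial>distr M (N1 \<Otimes>\<^sub>M N2) (\<lambda>\<omega>. (X \<omega>, Y \<omega>)))"
    by (subst nn_integral_distr) auto
  also have "\<dots> = (\<integral>\<^sup>+y. (case y of (x, z) \<Rightarrow> ennreal (p x z)) * H y \<partial>(distr M N1 X \<Otimes>\<^sub>M N2))"
    unfolding joint_law
    by (subst nn_integral_density) (auto cong: measurable_cong_sets[OF m refl])
  also have "\<dots> = (\<integral>\<^sup>+x. (\<integral>\<^sup>+z. ennreal (p x z) * H (x, z) \<partial>N2) \<partial>distr M N1 X)"
    by (subst N2.nn_integral_fst[symmetric]) (auto cong: measurable_cong_sets[OF m refl])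
  also have "\<dots> = (\<integral>\<^sup>+\<omega>. (\<integral>\<^sup>+z. ennreal (p (X \<omega>) z) * H (X \<omega>, z) \<partial>N2) \<partial>M)"
    by (subst nn_integral_distr) (auto)
  finally show ?thesis .
qed

text \<open>Fubini requires integrability over the product measure; it is obtained by transporting
  the integrability of the composite along \<open>joint_law\<close>.\<close>

lemma integral_joint:
  fixes H :: "'b \<times> 'c \<Rightarrow> real"
  assumes H[measurable]: "H \<in> borel_measurable (N1 \<Otimes>\<^sub>M N2)"
    and int: "integrable M (\<lambda>\<omega>. H (X \<omega>, Y \<omega>))"
  shows "(\<integral>\<omega>. H (X \<omega>, Y \<omega>) \<partial>M) = (\<integral>\<omega>. (\<integral>z. p (X \<omega>) z * H (X \<omega>, z) \<partial>N2) \<partial>M)"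
proof -
  interpret N2: sigma_finite_measure N2 by (rule sf)
  interpret DX: prob_space "distr M N1 X" by (rule prob_space_distr) measurable
  interpret DP: pair_sigma_finite "distr M N1 X" N2 ..
  let ?D = "distr M N1 X \<Otimes>\<^sub>M N2"
  have m: "sets ?D = sets (N1 \<Otimes>\<^sub>M N2)"
    by (intro sets_pair_measure_cong) auto
  have nn: "AE y in ?D. 0 \<le> (case y of (x, z) \<Rightarrow> p x z)"
    by (rule AE_I2) (auto simp: space_pair_measure p_nonneg)
  have law: "distr M (N1 \<Otimes>\<^sub>M N2) (\<lambda>\<omega>. (X \<omega>, Y \<omega>)) = density ?D (\<lambda>y. ennreal (case y of (x, z) \<Rightarrow> p x z))"
    unfolding joint_law by (intro arg_cong2[where f=density] refl ext) auto
  have [measurable]: "H \<in> borel_measurable ?D" "(\<lambda>(x, z). p x z) \<in> borel_measurable ?D"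
    by (auto cong: measurable_cong_sets[OF m refl])
  have "integrable (distr M (N1 \<Otimes>\<^sub>M N2) (\<lambda>\<omega>. (X \<omega>, Y \<omega>))) H"
    using int by (subst integrable_distr_eq) auto
  then have i2: "integrable ?D (\<lambda>y. (case y of (x, z) \<Rightarrow> p x z) *\<^sub>R H y)"
    unfolding law by (subst (asm) integrable_density[OF _ _ nn]) auto
  have "(\<integral>\<omega>. H (X \<omega>, Y \<omega>) \<partial>M) = (\<integral>y. H y \<partial>distr M (N1 \<Otimes>\<^sub>M N2) (\<lambda>\<omega>. (X \<omega>, Y \<omega>)))"
    by (subst integral_distr) auto
  also have "\<dots> = (\<integral>y. (case y of (x, z) \<Rightarrow> p x z) *\<^sub>R H y \<partial>?D)"
    unfolding law by (subst integral_density[OF _ _ nn]) auto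
  also have "\<dots> = (\<integral>x. (\<integral>z. p x z * H (x, z) \<partial>N2) \<partial>distr M N1 X)"
    by (subst DP.integral_fst'[OF i2, symmetric]) simp
  also have "\<dots> = (\<integral>\<omega>. (\<integral>z. p (X \<omega>) z * H (X \<omega>, z) \<partial>N2) \<partial>M)"
    by (subst integral_distr) (auto intro!: N2.borel_measurable_lebesgue_integral)
  finally show ?thesis .
qed

end


section \<open>Signed weights along an abstract Markov chain\<close>

section \<open>Weighted Markov chains\<close>

text \<open>The probabilistic argument is kept free of geometry. Kernels take the target point
  first, \<open>k m z y\<close>, densities the source first, \<open>p y z\<close>. As division by
  zero yields \<open>0\<close>, the conditions \<open>q_supp\<close> and \<open>p_supp\<close>
  ensure that the quotients lose nothing outside null sets.\<close>

locale weighted_markov_chain = prob_space M for M :: "'w measure" +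
  fixes n :: nat and F :: "nat \<Rightarrow> 'w measure" and Y :: "nat \<Rightarrow> 'w \<Rightarrow> 'a"
    and S :: "nat \<Rightarrow> 'a measure" and q f :: "'a \<Rightarrow> real" and p :: "'a \<Rightarrow> 'a \<Rightarrow> real"
    and k :: "nat \<Rightarrow> 'a \<Rightarrow> 'a \<Rightarrow> real"
  assumes sf: "\<And>m. m \<le> n \<Longrightarrow> sigma_finite_measure (S m)"
    and subalg: "\<And>m. m \<le> n \<Longrightarrow> subalgebra M (F m)"
    and Y_F: "\<And>l m. l \<le> m \<Longrightarrow> m \<le> n \<Longrightarrow> Y l \<in> F m \<rightarrow>\<^sub>M S l"
    and f: "f \<in> borel_measurable (S 0)"
    and q: "q \<in> borel_measurable (S 0)"
    and q_nonneg: "\<And>y. y \<in> space (S 0) \<Longrightarrow> 0 \<le> q y"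
    and q_supp: "AE y in S 0. f y \<noteq> 0 \<longrightarrow> q y \<noteq> 0"
    and Y_0: "distr M (S 0) (Y 0) = density (S 0) (\<lambda>y. ennreal (q y))"
    and k: "\<And>m. m < n \<Longrightarrow> (\<lambda>(y, z). k m z y) \<in> borel_measurable (S m \<Otimes>\<^sub>M S (Suc m))"
    and p: "\<And>m. m < n \<Longrightarrow> (\<lambda>(y, z). p y z) \<in> borel_measurable (S m \<Otimes>\<^sub>M S (Suc m))"
    and p_nonneg: "\<And>m y z. m < n \<Longrightarrow> y \<in> space (S m) \<Longrightarrow> z \<in> space (S (Suc m)) \<Longrightarrow> 0 \<le> p y z"
    and p_one: "\<And>m y. m < n \<Longrightarrow> y \<in> space (S m) \<Longrightarrow> (\<integral>\<^sup>+z. ennreal (p y z) \<partial>S (Suc m)) = 1"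
    and p_supp: "\<And>m y. m < n \<Longrightarrow> y \<in> space (S m) \<Longrightarrow>
      AE z in S (Suc m). k m z y \<noteq> 0 \<longrightarrow> p y z \<noteq> 0"
    and cond: "\<And>m B. m < n \<Longrightarrow> B \<in> sets (S (Suc m)) \<Longrightarrow> AE \<omega> in M.
      real_cond_exp M (F m) (\<lambda>\<omega>. indicator B (Y (Suc m) \<omega>)) \<omega> = (LINT z:B|S (Suc m). p (Y m \<omega>) z)"
begin

primrec weight :: "nat \<Rightarrow> 'w \<Rightarrow> real" where
  "weight 0 \<omega> = f (Y 0 \<omega>) / q (Y 0 \<omega>)"
| "weight (Suc m) \<omega> =
     weight m \<omega> * (k m (Y (Suc m) \<omega>) (Y m \<omega>) / p (Y m \<omega>) (Y (Suc m) \<omega>))"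

primrec iter :: "nat \<Rightarrow> 'a \<Rightarrow> real" where
  "iter 0 y = f y"
| "iter (Suc m) z = (LINT y|S m. k m z y * iter m y)"

text \<open>With values in \<open>ennreal\<close> the iterates of the absolute kernels make sense
  before any integrability is known.\<close>

primrec abs_iter :: "nat \<Rightarrow> 'a \<Rightarrow> ennreal" where
  "abs_iter 0 y = ennreal \<bar>f y\<bar>"
| "abs_iter (Suc m) z = (\<integral>\<^sup>+y. ennreal \<bar>k m z y\<bar> * abs_iter m y \<partial>S m)"

lemma Y_M: "m \<le> n \<Longrightarrow> Y m \<in> M \<rightarrow>\<^sub>M S m"
  using measurable_from_subalg[OF subalg Y_F[OF order_refl]] by blast

lemma k_measurable [measurable]:
  "m < n \<Longrightarrow> (\<lambda>x. k m (fst x) (snd x)) \<in> borel_measurable (S (Suc m) \<Otimes>\<^sub>M S m)"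
  "m < n \<Longrightarrow> (\<lambda>x. k m (snd x) (fst x)) \<in> borel_measurable (S m \<Otimes>\<^sub>M S (Suc m))"
  using k[of m] measurable_pair_swap[OF k[of m]] by (auto simp: case_prod_beta')

lemma p_measurable [measurable]:
  "m < n \<Longrightarrow> (\<lambda>x. p (fst x) (snd x)) \<in> borel_measurable (S m \<Otimes>\<^sub>M S (Suc m))"
  using p[of m] by (auto simp: case_prod_beta')

lemma iter_measurable: "m \<le> n \<Longrightarrow> iter m \<in> borel_measurable (S m)"
proof (induction m)
  case 0
  have "iter 0 = f" by auto
  with f show ?case by simp
next
  case (Suc m)
  then have [measurable]: "iter m \<in> borel_measurable (S m)" and m: "m < n" by auto
  interpret S: sigma_finite_measure "S m" using sf m by auto
  have "(\<lambda>(z, y). k m z y * iter m y) \<in> borel_measurable (S (Suc m) \<Otimes>\<^sub>M S m)"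
    using m unfolding case_prod_beta' by measurable
  from S.borel_measurable_lebesgue_integral[OF this] show ?case
    by simp
qed

lemma abs_iter_measurable: "m \<le> n \<Longrightarrow> abs_iter m \<in> borel_measurable (S m)"
proof (induction m)
  case 0
  have "abs_iter 0 = (\<lambda>y. ennreal \<bar>f y\<bar>)" by auto
  with f show ?case by simp
next
  case (Suc m)
  then have [measurable]: "abs_iter m \<in> borel_measurable (S m)" and m: "m < n" by auto
  interpret S: sigma_finite_measure "S m" using sf m by auto
  have "(\<lambda>(z, y). ennreal \<bar>k m z y\<bar> * abs_iter m y) \<in> borel_measurable (S (Suc m) \<Otimes>\<^sub>M S m)"
    using m unfolding case_prod_beta' by measurable
  from S.borel_measurable_nn_integral[OF this] show ?case
    by simp
qed

text \<open>Adaptedness lets the weight enter the conditioning variable. The index \<open>m\<close>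
  stays fixed in the induction because no inclusion between the algebras \<open>F m\<close> is
  assumed.\<close>

lemma weight_measurable: "l \<le> m \<Longrightarrow> m \<le> n \<Longrightarrow> weight l \<in> borel_measurable (F m)"
proof (induction l)
  case 0
  have [measurable]: "Y 0 \<in> F m \<rightarrow>\<^sub>M S 0" using Y_F 0 by simp
  have "weight 0 = (\<lambda>\<omega>. f (Y 0 \<omega>) / q (Y 0 \<omega>))" by auto
  moreover have "(\<lambda>\<omega>. f (Y 0 \<omega>) / q (Y 0 \<omega>)) \<in> borel_measurable (F m)"
    using f q by measurable
  ultimately show ?case by simp
next
  case (Suc l)
  then have [measurable]: "weight l \<in> borel_measurable (F m)"
    "Y l \<in> F m \<rightarrow>\<^sub>M S l" "Y (Suc l) \<in> F m \<rightarrow>\<^sub>M S (Suc l)"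
    and l: "l < n" using Y_F by auto
  have "(\<lambda>\<omega>. k l (Y (Suc l) \<omega>) (Y l \<omega>)) \<in> borel_measurable (F m)"
    "(\<lambda>\<omega>. p (Y l \<omega>) (Y (Suc l) \<omega>)) \<in> borel_measurable (F m)"
    using measurable_compose[OF _ k_measurable(2)[OF l], of "\<lambda>\<omega>. (Y l \<omega>, Y (Suc l) \<omega>)" "F m"]
      measurable_compose[OF _ p_measurable[OF l], of "\<lambda>\<omega>. (Y l \<omega>, Y (Suc l) \<omega>)" "F m"]
    by auto
  then show ?case by simp
qed

lemma abs_iter_bound: "ennreal \<bar>iter m y\<bar> \<le> abs_iter m y"
proof (induction m arbitrary: y)
  case (Suc m)
  show ?case
  \<comment> \<open>Without integrability the Bochner integral is \<open>0\<close> by convention,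
    and the bound is trivial.\<close>
  proof (cases "integrable (S m) (\<lambda>x. k m y x * iter m x)")
    case True
    have "ennreal \<bar>iter (Suc m) y\<bar> \<le> (\<integral>\<^sup>+x. ennreal (norm (k m y x * iter m x)) \<partial>S m)"
      using integral_norm_bound_ennreal[OF True] by simp
    also have "\<dots> \<le> abs_iter (Suc m) y"
      by (auto intro!: nn_integral_mono mult_left_mono Suc simp: abs_mult ennreal_mult)
    finally show ?thesis .
  qed (simp add: not_integrable_integral_eq)
qed simp

lemma conditional_density:
  assumes m: "m < n"
  shows "conditional_density M (F m) (\<lambda>\<omega>. (weight m \<omega>, Y m \<omega>)) (borel \<Otimes>\<^sub>M S m)
    (Y (Suc m)) (S (Suc m)) (\<lambda>wy z. p (snd wy) z)"
proof unfold_locales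
  have [measurable]: "weight m \<in> borel_measurable (F m)" "Y m \<in> F m \<rightarrow>\<^sub>M S m"
    using m weight_measurable[of m m] Y_F[of m m] by auto
  show "(\<lambda>\<omega>. (weight m \<omega>, Y m \<omega>)) \<in> F m \<rightarrow>\<^sub>M borel \<Otimes>\<^sub>M S m" by measurable
  have "(\<lambda>x. (snd (fst x), snd x)) \<in> (borel \<Otimes>\<^sub>M S m) \<Otimes>\<^sub>M S (Suc m) \<rightarrow>\<^sub>M S m \<Otimes>\<^sub>M S (Suc m)"
    by measurable
  from measurable_compose[OF this p_measurable[OF m]]
  show "(\<lambda>(x, z). p (snd x) z) \<in> borel_measurable ((borel \<Otimes>\<^sub>M S m) \<Otimes>\<^sub>M S (Suc m))"
    by (simp add: case_prod_beta')
qed (use m subalg Y_M sf[of "Suc m"] p_nonneg p_one cond in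
      \<open>auto simp: space_pair_measure sigma_finite_measure_def\<close>)

text \<open>Induction with \<open>G\<close> arbitrary: conditioning on the past trades
  \<open>G\<close> for its integral against the absolute kernel, the density cancelling the
  denominator of the last factor; Tonelli then moves that kernel over to
  \<open>abs_iter\<close>.\<close>

lemma nn_integral_weight:
  assumes "m \<le> n" "G \<in> borel_measurable (S m)"
  shows "(\<integral>\<^sup>+\<omega>. ennreal \<bar>weight m \<omega>\<bar> * G (Y m \<omega>) \<partial>M) = (\<integral>\<^sup>+y. G y * abs_iter m y \<partial>S m)"
  using assms
proof (induction m arbitrary: G)
  case 0
  note [measurable] = 0(2) f q
  have [measurable]: "Y 0 \<in> M \<rightarrow>\<^sub>M S 0" using Y_M by simp
  have "(\<integral>\<^sup>+\<omega>. ennreal \<bar>weight 0 \<omega>\<bar> * G (Y 0 \<omega>) \<partial>M) =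
      (\<integral>\<^sup>+y. ennreal \<bar>f y / q y\<bar> * G y \<partial>distr M (S 0) (Y 0))"
    by (subst nn_integral_distr) auto
  also have "\<dots> = (\<integral>\<^sup>+y. ennreal (q y) * (ennreal \<bar>f y / q y\<bar> * G y) \<partial>S 0)"
    unfolding Y_0 by (subst nn_integral_density) auto
  also have "\<dots> = (\<integral>\<^sup>+y. G y * abs_iter 0 y \<partial>S 0)"
  proof (rule nn_integral_cong_AE)
    show "AE y in S 0. ennreal (q y) * (ennreal \<bar>f y / q y\<bar> * G y) = G y * abs_iter 0 y"
      using q_supp AE_space
    \<comment> \<open>Where \<open>q y = 0\<close>, also \<open>f y = 0\<close> by
      \<open>q_supp\<close>, and both sides vanish; elsewhere \<open>q y\<close> cancels.\<close>
    proof eventually_elim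
      case (elim y)
      then have "ennreal (q y) * ennreal \<bar>f y / q y\<bar> = ennreal \<bar>f y\<bar>"
        using q_nonneg[of y] by (auto simp: abs_divide simp flip: ennreal_mult')
      then show ?case by (simp add: mult_ac flip: mult.assoc)
    qed
  qed
  finally show ?case .
next
  case (Suc m)
  then have m: "m < n" by simp
  note [measurable] = Suc(3) k_measurable[OF m] p_measurable[OF m] abs_iter_measurable[OF less_imp_le[OF m]]
  interpret C: conditional_density M "F m" "\<lambda>\<omega>. (weight m \<omega>, Y m \<omega>)" "borel \<Otimes>\<^sub>M S m"
    "Y (Suc m)" "S (Suc m)" "\<lambda>wy z. p (snd wy) z" by (rule conditional_density[OF m])
  interpret S: sigma_finite_measure "S m" using sf m by auto
  interpret S': sigma_finite_measure "S (Suc m)" using sf m by auto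
  interpret P: pair_sigma_finite "S m" "S (Suc m)" ..
  let ?H = "\<lambda>((w, y), z). ennreal \<bar>w * (k m z y / p y z)\<bar> * G z"
  have [measurable]: "(\<lambda>x. (snd (fst x), snd x)) \<in> (borel \<Otimes>\<^sub>M S m) \<Otimes>\<^sub>M S (Suc m) \<rightarrow>\<^sub>M S m \<Otimes>\<^sub>M S (Suc m)"
    by measurable
  have [measurable]: "(\<lambda>x. k m (snd x) (snd (fst x))) \<in> borel_measurable ((borel \<Otimes>\<^sub>M S m) \<Otimes>\<^sub>M S (Suc m))"
    "(\<lambda>x. p (snd (fst x)) (snd x)) \<in> borel_measurable ((borel \<Otimes>\<^sub>M S m) \<Otimes>\<^sub>M S (Suc m))"
    using measurable_compose[OF \<open>(\<lambda>x. (snd (fst x), snd x)) \<in> _\<close> k_measurable(2)[OF m]]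
      measurable_compose[OF \<open>(\<lambda>x. (snd (fst x), snd x)) \<in> _\<close> p_measurable[OF m]] by auto
  have H: "?H \<in> borel_measurable ((borel \<Otimes>\<^sub>M S m) \<Otimes>\<^sub>M S (Suc m))"
    unfolding case_prod_beta' by measurable
  let ?G = "\<lambda>y. \<integral>\<^sup>+z. ennreal \<bar>k m z y\<bar> * G z \<partial>S (Suc m)"
  have G: "?G \<in> borel_measurable (S m)"
    using S'.borel_measurable_nn_integral[of "\<lambda>y z. ennreal \<bar>k m z y\<bar> * G z" "S m"]
    unfolding case_prod_beta' by simp
  have [measurable]: "(\<lambda>z. k m z y) \<in> borel_measurable (S (Suc m))"
    "p y \<in> borel_measurable (S (Suc m))" if "y \<in> space (S m)" for y
    using measurable_Pair2[OF k_measurable(2)[OF m] that] measurable_Pair2[OF p_measurable[OF m] that]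
    by simp_all
  have "(\<integral>\<^sup>+\<omega>. ennreal \<bar>weight (Suc m) \<omega>\<bar> * G (Y (Suc m) \<omega>) \<partial>M) =
      (\<integral>\<^sup>+\<omega>. ?H ((weight m \<omega>, Y m \<omega>), Y (Suc m) \<omega>) \<partial>M)" by simp
  also have "\<dots> = (\<integral>\<^sup>+\<omega>. (\<integral>\<^sup>+z. ennreal (p (Y m \<omega>) z) * ?H ((weight m \<omega>, Y m \<omega>), z) \<partial>S (Suc m)) \<partial>M)"
    by (subst C.nn_integral_joint[OF H]) simp
  also have "\<dots> = (\<integral>\<^sup>+\<omega>. ennreal \<bar>weight m \<omega>\<bar> * ?G (Y m \<omega>) \<partial>M)"
  \<comment> \<open>Cancellation works for each outcome separately, since \<open>p_supp\<close>
    holds at every position \<open>y\<close> and its exceptional null set concerns \<open>z\<close>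
    only.\<close>
  proof (intro nn_integral_cong)
    fix \<omega> assume "\<omega> \<in> space M"
    then have y: "Y m \<omega> \<in> space (S m)" using measurable_space[OF Y_M[of m]] m by auto
    have "(\<integral>\<^sup>+z. ennreal (p (Y m \<omega>) z) * ?H ((weight m \<omega>, Y m \<omega>), z) \<partial>S (Suc m)) =
      (\<integral>\<^sup>+z. ennreal \<bar>weight m \<omega>\<bar> * (ennreal \<bar>k m z (Y m \<omega>)\<bar> * G z) \<partial>S (Suc m))"
    proof (rule nn_integral_cong_AE)
      show "AE z in S (Suc m). ennreal (p (Y m \<omega>) z) * ?H ((weight m \<omega>, Y m \<omega>), z) =
          ennreal \<bar>weight m \<omega>\<bar> * (ennreal \<bar>k m z (Y m \<omega>)\<bar> * G z)"
        using p_supp[OF m y] AE_space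
      proof eventually_elim
        case (elim z)
        then have "ennreal (p (Y m \<omega>) z) * ennreal \<bar>weight m \<omega> * (k m z (Y m \<omega>) / p (Y m \<omega>) z)\<bar> =
            ennreal \<bar>weight m \<omega>\<bar> * ennreal \<bar>k m z (Y m \<omega>)\<bar>"
          using p_nonneg[OF m y, of z]
          by (auto simp: abs_mult abs_divide simp flip: ennreal_mult')
        then show ?case by (simp flip: mult.assoc)
      qed
    qed
    also have "\<dots> = ennreal \<bar>weight m \<omega>\<bar> * ?G (Y m \<omega>)"
      by (rule nn_integral_cmult) (use y in measurable)
    finally show "(\<integral>\<^sup>+z. ennreal (p (Y m \<omega>) z) * ?H ((weight m \<omega>, Y m \<omega>), z) \<partial>S (Suc m)) =
      ennreal \<bar>weight m \<omega>\<bar> * ?G (Y m \<omega>)" .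
  qed
  also have "\<dots> = (\<integral>\<^sup>+y. ?G y * abs_iter m y \<partial>S m)"
    by (rule Suc.IH[OF _ G]) (use m in simp)
  also have "\<dots> = (\<integral>\<^sup>+y. (\<integral>\<^sup>+z. ennreal \<bar>k m z y\<bar> * G z * abs_iter m y \<partial>S (Suc m)) \<partial>S m)"
    by (intro nn_integral_cong nn_integral_multc[symmetric]) measurable
  also have "\<dots> = (\<integral>\<^sup>+z. (\<integral>\<^sup>+y. ennreal \<bar>k m z y\<bar> * G z * abs_iter m y \<partial>S m) \<partial>S (Suc m))"
    by (rule P.Fubini'[symmetric]) (unfold case_prod_beta', measurable)
  also have "\<dots> = (\<integral>\<^sup>+z. G z * abs_iter (Suc m) z \<partial>S (Suc m))"
  proof (intro nn_integral_cong)
    fix z assume z: "z \<in> space (S (Suc m))"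
    have [measurable]: "k m z \<in> borel_measurable (S m)"
      using measurable_Pair2[OF k_measurable(1)[OF m] z] by simp
    have "(\<integral>\<^sup>+y. ennreal \<bar>k m z y\<bar> * G z * abs_iter m y \<partial>S m) = (\<integral>\<^sup>+y. G z * (ennreal \<bar>k m z y\<bar> * abs_iter m y) \<partial>S m)"
      by (simp add: mult_ac)
    also have "\<dots> = G z * abs_iter (Suc m) z"
      by (simp add: nn_integral_cmult)
    finally show "(\<integral>\<^sup>+y. ennreal \<bar>k m z y\<bar> * G z * abs_iter m y \<partial>S m) = G z * abs_iter (Suc m) z" .
  qed
  finally show ?case .
qed

text \<open>The first claim is \<open>nn_integral_weight\<close> for the absolute value of
  \<open>G\<close>; the second holds because \<open>abs_iter\<close> dominates
  \<open>iter\<close>.\<close>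

lemma integrable_weight:
  assumes m: "m \<le> n" and [measurable]: "G \<in> borel_measurable (S m)"
    and fin: "(\<integral>\<^sup>+y. ennreal \<bar>G y\<bar> * abs_iter m y \<partial>S m) < \<infinity>"
  shows "integrable M (\<lambda>\<omega>. weight m \<omega> * G (Y m \<omega>))" (is ?A)
    and "integrable (S m) (\<lambda>y. G y * iter m y)" (is ?B)
proof -
  have [measurable]: "weight m \<in> borel_measurable M" "Y m \<in> M \<rightarrow>\<^sub>M S m"
    "iter m \<in> borel_measurable (S m)" "abs_iter m \<in> borel_measurable (S m)"
    using measurable_from_subalg[OF subalg weight_measurable[OF order_refl]] m Y_M
      iter_measurable abs_iter_measurable by auto
  have "(\<integral>\<^sup>+\<omega>. ennreal (norm (weight m \<omega> * G (Y m \<omega>))) \<partial>M) < \<infinity>"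
    using nn_integral_weight[of m "\<lambda>y. ennreal \<bar>G y\<bar>"] m fin by (simp add: abs_mult ennreal_mult)
  then show ?A by (intro integrableI_bounded) measurable
  have "(\<integral>\<^sup>+y. ennreal (norm (G y * iter m y)) \<partial>S m) \<le> (\<integral>\<^sup>+y. ennreal \<bar>G y\<bar> * abs_iter m y \<partial>S m)"
    by (intro nn_integral_mono) (auto simp: abs_mult ennreal_mult intro!: mult_left_mono abs_iter_bound)
  with fin show ?B by (intro integrableI_bounded) auto
qed

text \<open>The signed counterpart of \<open>nn_integral_weight\<close>, by the same induction.
  Finiteness is now required twice in each step: for Fubini, and for the new test function
  \<open>?G\<close> in the induction hypothesis.\<close>

theorem expectation_weight:
  assumes "m \<le> n" "G \<in> borel_measurable (S m)"
    and "(\<integral>\<^sup>+y. ennreal \<bar>G y\<bar> * abs_iter m y \<partial>S m) < \<infinity>"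
  shows "(\<integral>\<omega>. weight m \<omega> * G (Y m \<omega>) \<partial>M) = (\<integral>y. G y * iter m y \<partial>S m)"
  using assms
proof (induction m arbitrary: G)
  case 0
  note [measurable] = 0(2) f q
  have [measurable]: "Y 0 \<in> M \<rightarrow>\<^sub>M S 0" using Y_M by simp
  have "(\<integral>\<omega>. weight 0 \<omega> * G (Y 0 \<omega>) \<partial>M) = (\<integral>y. f y / q y * G y \<partial>distr M (S 0) (Y 0))"
    by (subst integral_distr) auto
  also have "\<dots> = (\<integral>y. q y *\<^sub>R (f y / q y * G y) \<partial>S 0)"
    unfolding Y_0 by (subst integral_density) (auto simp: q_nonneg intro!: AE_I2)
  also have "\<dots> = (\<integral>y. G y * iter 0 y \<partial>S 0)"
    using q_supp by (intro integral_cong_AE) auto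
  finally show ?case .
next
  case (Suc m)
  then have m: "m < n" by simp
  note [measurable] = Suc(3) k_measurable[OF m] p_measurable[OF m] abs_iter_measurable[OF less_imp_le[OF m]]
    iter_measurable[OF less_imp_le[OF m]]
  interpret C: conditional_density M "F m" "\<lambda>\<omega>. (weight m \<omega>, Y m \<omega>)" "borel \<Otimes>\<^sub>M S m"
    "Y (Suc m)" "S (Suc m)" "\<lambda>wy z. p (snd wy) z" by (rule conditional_density[OF m])
  interpret S: sigma_finite_measure "S m" using sf m by auto
  interpret S': sigma_finite_measure "S (Suc m)" using sf m by auto
  interpret P: pair_sigma_finite "S m" "S (Suc m)" ..
  interpret P': pair_sigma_finite "S (Suc m)" "S m" ..
  let ?H = "\<lambda>((w, y), z). w * (k m z y / p y z) * G z"
  have [measurable]: "(\<lambda>x. (snd (fst x), snd x)) \<in> (borel \<Otimes>\<^sub>M S m) \<Otimes>\<^sub>M S (Suc m) \<rightarrow>\<^sub>M S m \<Otimes>\<^sub>M S (Suc m)"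
    by measurable
  have [measurable]: "(\<lambda>x. k m (snd x) (snd (fst x))) \<in> borel_measurable ((borel \<Otimes>\<^sub>M S m) \<Otimes>\<^sub>M S (Suc m))"
    "(\<lambda>x. p (snd (fst x)) (snd x)) \<in> borel_measurable ((borel \<Otimes>\<^sub>M S m) \<Otimes>\<^sub>M S (Suc m))"
    using measurable_compose[OF \<open>(\<lambda>x. (snd (fst x), snd x)) \<in> _\<close> k_measurable(2)[OF m]]
      measurable_compose[OF \<open>(\<lambda>x. (snd (fst x), snd x)) \<in> _\<close> p_measurable[OF m]] by auto
  have H: "?H \<in> borel_measurable ((borel \<Otimes>\<^sub>M S m) \<Otimes>\<^sub>M S (Suc m))"
    unfolding case_prod_beta' by measurable
  let ?G = "\<lambda>y. \<integral>z. k m z y * G z \<partial>S (Suc m)"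
  have G: "?G \<in> borel_measurable (S m)"
    using S'.borel_measurable_lebesgue_integral[of "\<lambda>y z. k m z y * G z" "S m"]
    unfolding case_prod_beta' by simp
  have [measurable]: "(\<lambda>z. k m z y) \<in> borel_measurable (S (Suc m))"
    "p y \<in> borel_measurable (S (Suc m))" if "y \<in> space (S m)" for y
    using measurable_Pair2[OF k_measurable(2)[OF m] that] measurable_Pair2[OF p_measurable[OF m] that]
    by simp_all
  \<comment> \<open>The finiteness assumption for \<open>Suc m\<close>, rewritten by Tonelli as a
    double integral; it yields \<open>finG\<close> and also justifies Fubini below.\<close>
  have fin: "(\<integral>\<^sup>+y. \<integral>\<^sup>+z. ennreal \<bar>k m z y\<bar> * ennreal \<bar>G z\<bar> * abs_iter m y \<partial>S (Suc m) \<partial>S m) < \<infinity>"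
  proof -
    have "(\<integral>\<^sup>+y. \<integral>\<^sup>+z. ennreal \<bar>k m z y\<bar> * ennreal \<bar>G z\<bar> * abs_iter m y \<partial>S (Suc m) \<partial>S m) =
      (\<integral>\<^sup>+z. \<integral>\<^sup>+y. ennreal \<bar>k m z y\<bar> * ennreal \<bar>G z\<bar> * abs_iter m y \<partial>S m \<partial>S (Suc m))"
      by (rule P.Fubini'[symmetric]) (unfold case_prod_beta', measurable)
    also have "\<dots> = (\<integral>\<^sup>+z. ennreal \<bar>G z\<bar> * abs_iter (Suc m) z \<partial>S (Suc m))"
    proof (intro nn_integral_cong)
      fix z assume z: "z \<in> space (S (Suc m))"
      have [measurable]: "k m z \<in> borel_measurable (S m)"
        using measurable_Pair2[OF k_measurable(1)[OF m] z] by simp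
      have "(\<integral>\<^sup>+y. ennreal \<bar>k m z y\<bar> * ennreal \<bar>G z\<bar> * abs_iter m y \<partial>S m) =
          (\<integral>\<^sup>+y. ennreal \<bar>G z\<bar> * (ennreal \<bar>k m z y\<bar> * abs_iter m y) \<partial>S m)"
        by (simp add: mult_ac)
      also have "\<dots> = ennreal \<bar>G z\<bar> * abs_iter (Suc m) z"
        by (simp add: nn_integral_cmult)
      finally show "(\<integral>\<^sup>+y. ennreal \<bar>k m z y\<bar> * ennreal \<bar>G z\<bar> * abs_iter m y \<partial>S m) =
        ennreal \<bar>G z\<bar> * abs_iter (Suc m) z" .
    qed
    finally show ?thesis using Suc(4) by simp
  qed
  have finG: "(\<integral>\<^sup>+y. ennreal \<bar>?G y\<bar> * abs_iter m y \<partial>S m) < \<infinity>"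
  proof (rule le_less_trans[OF _ fin], rule nn_integral_mono)
    fix y assume y: "y \<in> space (S m)"
    have "ennreal \<bar>?G y\<bar> \<le> (\<integral>\<^sup>+z. ennreal \<bar>k m z y\<bar> * ennreal \<bar>G z\<bar> \<partial>S (Suc m))"
    proof (cases "integrable (S (Suc m)) (\<lambda>z. k m z y * G z)")
      case True
      from integral_norm_bound_ennreal[OF this] show ?thesis
        by (simp add: abs_mult ennreal_mult)
    qed (simp add: not_integrable_integral_eq)
    then have "ennreal \<bar>?G y\<bar> * abs_iter m y \<le>
        (\<integral>\<^sup>+z. ennreal \<bar>k m z y\<bar> * ennreal \<bar>G z\<bar> \<partial>S (Suc m)) * abs_iter m y"
      by (rule mult_right_mono) simp
    also have "\<dots> = (\<integral>\<^sup>+z. ennreal \<bar>k m z y\<bar> * ennreal \<bar>G z\<bar> * abs_iter m y \<partial>S (Suc m))"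
      by (rule nn_integral_multc[symmetric]) (use y in measurable)
    finally show "ennreal \<bar>?G y\<bar> * abs_iter m y \<le>
      (\<integral>\<^sup>+z. ennreal \<bar>k m z y\<bar> * ennreal \<bar>G z\<bar> * abs_iter m y \<partial>S (Suc m))" .
  qed
  have "(\<integral>\<omega>. weight (Suc m) \<omega> * G (Y (Suc m) \<omega>) \<partial>M) =
      (\<integral>\<omega>. ?H ((weight m \<omega>, Y m \<omega>), Y (Suc m) \<omega>) \<partial>M)" by simp
  also have "\<dots> = (\<integral>\<omega>. (\<integral>z. p (Y m \<omega>) z * ?H ((weight m \<omega>, Y m \<omega>), z) \<partial>S (Suc m)) \<partial>M)"
    using integrable_weight(1)[OF Suc(2,3,4)] by (subst C.integral_joint[OF H]) simp_all
  also have "\<dots> = (\<integral>\<omega>. weight m \<omega> * ?G (Y m \<omega>) \<partial>M)"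
  proof (intro Bochner_Integration.integral_cong refl)
    fix \<omega> assume "\<omega> \<in> space M"
    then have y: "Y m \<omega> \<in> space (S m)" using measurable_space[OF Y_M[of m]] m by auto
    have "(\<integral>z. p (Y m \<omega>) z * ?H ((weight m \<omega>, Y m \<omega>), z) \<partial>S (Suc m)) =
      (\<integral>z. weight m \<omega> * (k m z (Y m \<omega>) * G z) \<partial>S (Suc m))"
    proof (rule integral_cong_AE)
      show "AE z in S (Suc m). p (Y m \<omega>) z * ?H ((weight m \<omega>, Y m \<omega>), z) =
          weight m \<omega> * (k m z (Y m \<omega>) * G z)"
        using p_supp[OF m y] by eventually_elim auto
    qed (use y in \<open>(simp; measurable)+\<close>)
    then show "(\<integral>z. p (Y m \<omega>) z * ?H ((weight m \<omega>, Y m \<omega>), z) \<partial>S (Suc m)) =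
      weight m \<omega> * ?G (Y m \<omega>)" by simp
  qed
  also have "\<dots> = (\<integral>y. ?G y * iter m y \<partial>S m)"
    by (rule Suc.IH[OF _ G finG]) (use m in simp)
  also have "\<dots> = (\<integral>y. \<integral>z. k m z y * G z * iter m y \<partial>S (Suc m) \<partial>S m)"
    by simp
  also have "\<dots> = (\<integral>z. \<integral>y. k m z y * G z * iter m y \<partial>S m \<partial>S (Suc m))"
  proof (rule P.Fubini_integral[symmetric])
    have [measurable]: "(\<lambda>x. k m (snd x) (fst x) * G (snd x) * iter m (fst x)) \<in> borel_measurable (S m \<Otimes>\<^sub>M S (Suc m))"
      by measurable
    have "(\<integral>\<^sup>+x. ennreal (norm (k m (snd x) (fst x) * G (snd x) * iter m (fst x))) \<partial>(S m \<Otimes>\<^sub>M S (Suc m))) =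
      (\<integral>\<^sup>+y. \<integral>\<^sup>+z. ennreal (norm (k m z y * G z * iter m y)) \<partial>S (Suc m) \<partial>S m)"
      by (subst S'.nn_integral_fst[symmetric]) auto
    also have "\<dots> \<le> (\<integral>\<^sup>+y. \<integral>\<^sup>+z. ennreal \<bar>k m z y\<bar> * ennreal \<bar>G z\<bar> * abs_iter m y \<partial>S (Suc m) \<partial>S m)"
      by (intro nn_integral_mono)
         (auto simp: abs_mult ennreal_mult intro!: mult_left_mono abs_iter_bound)
    finally have "(\<integral>\<^sup>+x. ennreal (norm (k m (snd x) (fst x) * G (snd x) * iter m (fst x))) \<partial>(S m \<Otimes>\<^sub>M S (Suc m))) < \<infinity>"
      using fin by (rule le_less_trans)
    then show "integrable (S m \<Otimes>\<^sub>M S (Suc m)) (\<lambda>(y, z). k m z y * G z * iter m y)"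
      unfolding case_prod_beta' by (intro integrableI_bounded) auto
  qed
  also have "\<dots> = (\<integral>z. G z * iter (Suc m) z \<partial>S (Suc m))"
    by (intro Bochner_Integration.integral_cong refl) (simp flip: integral_mult_right_zero add: mult_ac)
  finally show ?case .
qed

text \<open>Kernels whose absolute integral over the source is bounded uniformly in the target map
  bounded functions to bounded functions, so the bounds multiply from step to step.\<close>

lemma abs_iter_bounded:
  assumes f: "\<And>y. y \<in> space (S 0) \<Longrightarrow> \<bar>f y\<bar> \<le> B0"
    and K: "\<And>m. m < n \<Longrightarrow>
      \<exists>K. \<forall>z\<in>space (S (Suc m)). (\<integral>\<^sup>+y. ennreal \<bar>k m z y\<bar> \<partial>S m) \<le> ennreal K"
    and m: "m \<le> n"
  shows "\<exists>B. \<forall>y\<in>space (S m). abs_iter m y \<le> ennreal B"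
  using m
proof (induction m)
  case 0
  then show ?case using f by (auto intro!: exI[of _ B0] ennreal_leI)
next
  case (Suc m)
  then have m: "m < n" by simp
  obtain B where B: "\<And>y. y \<in> space (S m) \<Longrightarrow> abs_iter m y \<le> ennreal B"
    using Suc by auto
  obtain K where K: "\<And>z. z \<in> space (S (Suc m)) \<Longrightarrow> (\<integral>\<^sup>+y. ennreal \<bar>k m z y\<bar> \<partial>S m) \<le> ennreal K"
    using assms(2)[OF m] by blast
  \<comment> \<open>\<open>K\<close> and \<open>B\<close> may be negative, where
    \<open>ennreal\<close> truncates to \<open>0\<close>; the absolute values keep the product bound
    valid.\<close>
  have "abs_iter (Suc m) z \<le> ennreal (\<bar>K\<bar> * \<bar>B\<bar>)" if z: "z \<in> space (S (Suc m))" for z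
  proof -
    have [measurable]: "k m z \<in> borel_measurable (S m)"
      using measurable_Pair2[OF k_measurable(1)[OF m] z] by simp
    have "abs_iter (Suc m) z \<le> (\<integral>\<^sup>+y. ennreal \<bar>k m z y\<bar> * ennreal B \<partial>S m)"
      using B by (auto intro!: nn_integral_mono mult_left_mono)
    also have "\<dots> = (\<integral>\<^sup>+y. ennreal \<bar>k m z y\<bar> \<partial>S m) * ennreal B"
      by (rule nn_integral_multc) measurable
    also have "\<dots> \<le> ennreal K * ennreal B"
      using K[OF z] by (rule mult_right_mono) simp
    also have "\<dots> \<le> ennreal (\<bar>K\<bar> * \<bar>B\<bar>)"
      by (simp add: ennreal_mult mult_mono ennreal_leI)
    finally show ?thesis .
  qed
  then show ?case by blast
qed

end

section \<open>Upper area bounds from coverings by small cells\<close>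

section \<open>Surface measure of Lipschitz pieces\<close>

lemma sets_hausdorff_measure [simp, measurable_cong]: "sets (hausdorff_measure k) = sets borel"
  unfolding hausdorff_measure_def
  by (metis sets.sigma_sets_eq sets_measure_of space_borel subset_UNIV Pow_UNIV)

lemma space_hausdorff_measure [simp]: "space (hausdorff_measure k) = UNIV"
  using sets_eq_imp_space_eq[OF sets_hausdorff_measure] by simp

text \<open>
  Upper bounds hold without knowing that the set function is countably additive, because
  \<^const>\<open>measure_of\<close> yields the null measure when it is not.
\<close>

lemma emeasure_hausdorff_measure_le:
  "emeasure (hausdorff_measure k) A \<le> (SUP \<delta>\<in>{0<..}. hausdorff_pre k \<delta> A)"
  unfolding hausdorff_measure_def by (simp add: emeasure_measure_of_conv)

text \<open>
  The points of \<open>E\<close> whose \<open>k\<close> coordinates fall into a common cell of side \<open>r / n\<close> form a set of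
  diameter at most \<open>L k r / n\<close>, and there are at most \<open>(2 n)\<^sup>k\<close> such cells.
\<close>

lemma hausdorff_measure_le_coordinates:
  fixes E :: "'a::euclidean_space set"
  assumes D: "finite D" "card D = k" "k \<ge> 1" and L: "0 \<le> L" and r: "0 < r"
    and bound: "\<And>z b. z \<in> E \<Longrightarrow> b \<in> D \<Longrightarrow> \<bar>(z - c) \<bullet> b\<bar> < r"
    and lip: "\<And>z w. z \<in> E \<Longrightarrow> w \<in> E \<Longrightarrow> norm (z - w) \<le> L * (\<Sum>b\<in>D. \<bar>(z - w) \<bullet> b\<bar>)"
  shows "emeasure (hausdorff_measure k) E \<le> ennreal (unit_ball_vol k * (L * k) ^ k * r ^ k)"
proof (rule order_trans[OF emeasure_hausdorff_measure_le SUP_least])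
  fix \<delta> :: real assume "\<delta> \<in> {0<..}"
  then have \<delta>: "0 < \<delta>" by simp
  \<comment> \<open>The mesh is fine enough for the cell diameter \<open>d\<close> to be at most
    \<delta>; the successor taken next ensures \<open>n > 0\<close>.\<close>
  obtain n0 :: nat where n0: "L * k * r / \<delta> \<le> real n0" using real_arch_simple by blast
  define n where "n = Suc n0"
  have n: "0 < n" "L * k * r / \<delta> \<le> real n" using n0 by (auto simp: n_def)
  define d where "d = L * k * r / n"
  have d: "0 \<le> d" "d \<le> \<delta>" using n \<delta> L r by (auto simp: d_def field_simps)
  define cell where "cell z = (\<lambda>b\<in>D. \<lfloor>n * ((z - c) \<bullet> b) / r\<rfloor>)" for z
  \<comment> \<open>The coordinates lie strictly between \<open>- r\<close> and \<open>r\<close>, so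
    each scaled floor takes one of \<open>2 * n\<close> values.\<close>
  define J where "J = (\<Pi>\<^sub>E b\<in>D. {- int n..<int n})"
  have J: "finite J" "card J = (2 * n) ^ k"
    using D by (auto simp: J_def card_PiE finite_PiE nat_mult_distrib power_mult_distrib)
  have cellJ: "cell z \<in> J" if z: "z \<in> E" for z
  proof -
    have "\<lfloor>n * ((z - c) \<bullet> b) / r\<rfloor> \<in> {- int n..<int n}" if b: "b \<in> D" for b
    proof -
      have "\<bar>n * ((z - c) \<bullet> b) / r\<bar> < n"
        using bound[OF z b] n r by (simp add: abs_mult divide_less_eq)
      then have "- real n \<le> n * ((z - c) \<bullet> b) / r" "n * ((z - c) \<bullet> b) / r < real n"
        unfolding abs_less_iff by simp_all
      then show ?thesis by (simp add: le_floor_iff floor_less_iff)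
    qed
    then show ?thesis by (auto simp: J_def cell_def)
  qed
  have diam: "norm (z - w) \<le> d" if zw: "z \<in> E" "w \<in> E" "cell z = cell w" for z w
  proof -
    have "\<bar>(z - w) \<bullet> b\<bar> \<le> r / n" if b: "b \<in> D" for b
    proof -
      have "\<lfloor>n * ((z - c) \<bullet> b) / r\<rfloor> = \<lfloor>n * ((w - c) \<bullet> b) / r\<rfloor>"
        using fun_cong[OF zw(3), of b] b by (simp add: cell_def)
      then have "\<bar>n * ((z - c) \<bullet> b) / r - n * ((w - c) \<bullet> b) / r\<bar> \<le> 1" by linarith
      moreover have "n * ((z - c) \<bullet> b) / r - n * ((w - c) \<bullet> b) / r = (n / r) * ((z - w) \<bullet> b)"
        using r by (simp add: inner_diff_left field_simps)
      ultimately show ?thesis using n r by (simp add: abs_mult field_simps)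
    qed
    then have "(\<Sum>b\<in>D. \<bar>(z - w) \<bullet> b\<bar>) \<le> k * (r / n)"
      using sum_bounded_above[of D "\<lambda>b. \<bar>(z - w) \<bullet> b\<bar>" "r / n"] D by simp
    from mult_left_mono[OF this L] show ?thesis
      using lip[OF zw(1,2)] by (simp add: d_def)
  qed
  \<comment> \<open>Coverings in \<open>hausdorff_pre\<close> are sequences, so the cells are
    enumerated and padded with empty sets, which contribute \<open>0 ^ k = 0\<close> because
    \<open>k \<ge> 1\<close>.\<close>
  obtain g where g: "bij_betw g {0..<card J} J" using ex_bij_betw_nat_finite[OF J(1)] by blast
  define U where "U i = (if i < card J then {z \<in> E. cell z = g i} else {})" for i
  have diamU: "diameter (U i) \<le> d" for i
    by (rule diameter_le) (use d diam in \<open>auto simp: U_def split: if_splits\<close>)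
  have "bounded (U i)" for i
  proof (cases "U i = {}")
    case False
    then obtain z where "z \<in> U i" by auto
    then have "U i \<subseteq> cball z d" using diam by (auto simp: U_def dist_norm split: if_splits)
    then show ?thesis using bounded_subset bounded_cball by blast
  qed simp
  moreover have "E \<subseteq> (\<Union>i. U i)"
  proof
    fix z assume z: "z \<in> E"
    then obtain i where "i < card J" "g i = cell z"
      using cellJ[OF z] g by (metis atLeastLessThan_iff bij_betw_iff_bijections)
    with z show "z \<in> (\<Union>i. U i)" by (auto simp: U_def intro!: exI[of _ i])
  qed
  ultimately have "hausdorff_pre k \<delta> E \<le> (\<Sum>i. ennreal (unit_ball_vol k * (diameter (U i) / 2) ^ k))"
    unfolding hausdorff_pre_def using diamU d(2) by (intro INF_lower) (auto intro: order_trans)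
  also have "\<dots> = (\<Sum>i<card J. ennreal (unit_ball_vol k * (diameter (U i) / 2) ^ k))"
    by (rule suminf_finite) (use D(3) in \<open>auto simp: U_def\<close>)
  also have "\<dots> \<le> (\<Sum>i<card J. ennreal (unit_ball_vol k * (d / 2) ^ k))"
    by (intro sum_mono ennreal_leI mult_left_mono power_mono divide_right_mono diamU)
       (auto intro!: diameter_ge_0 \<open>\<And>i. bounded (U i)\<close>)
  also have "\<dots> = ennreal (card J * (unit_ball_vol k * (d / 2) ^ k))"
    by (simp add: ennreal_of_nat_eq_real_of_nat ennreal_mult')
  \<comment> \<open>The factor \<open>2 ^ k\<close> in the number of cells cancels the halving of
    the diameters, and \<open>n\<close> drops out, so the bound does not depend on \<delta>.\<close>
  also have "card J * (unit_ball_vol k * (d / 2) ^ k) = unit_ball_vol k * ((2 * real n) * (d / 2)) ^ k"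
    by (simp add: J power_mult_distrib power_divide)
  also have "(2 * real n) * (d / 2) = L * k * r" using n by (simp add: d_def)
  finally show "hausdorff_pre k \<delta> E \<le> ennreal (unit_ball_vol k * (L * k) ^ k * r ^ k)"
    by (simp add: power_mult_distrib mult_ac)
qed

lemma space_surface_measure [simp]: "space (surface_measure S) = S"
  by (simp add: surface_measure_def space_restrict_space)

lemma sets_surface_measure: "sets (surface_measure S) = sets (restrict_space borel S)"
  unfolding surface_measure_def by (rule sets_restrict_space_cong) simp

text \<open>Upper Ahlfors regularity. The centres range over the whole space, so that potentials can
  also be estimated at points off the surface.\<close>

definition upper_regular :: "'a::euclidean_space set \<Rightarrow> real \<Rightarrow> bool" where
  "upper_regular S C \<longleftrightarrow> 0 \<le> C \<and>
     (\<forall>c r. 0 < r \<longrightarrow> emeasure (surface_measure S) (S \<inter> ball c r) \<le> ennreal (C * r ^ (DIM('a) - 1)))"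

section \<open>Uniform bounds for weakly singular surface integrals\<close>

section \<open>Weakly singular integrals\<close>

text \<open>The least \<open>j\<close> with the second property works: for \<open>j = 0\<close> the
  first property is \<open>d < R\<close>, otherwise it is minimality at the predecessor.\<close>

lemma dyadic_shell:
  fixes R d :: real
  assumes "0 < d" "d < R"
  obtains j where "d < R / 2 ^ j" "R / 2 ^ Suc j \<le> d"
proof -
  obtain n where n: "R / d < 2 ^ n" using real_arch_pow[of 2 "R / d"] by auto
  have "R / 2 ^ Suc n \<le> d"
  proof -
    have "R < 2 ^ n * d" using n assms by (simp add: field_simps)
    also have "\<dots> \<le> 2 ^ Suc n * d" using assms by simp
    finally show ?thesis by (simp add: field_simps)
  qed
  define j where "j = (LEAST j. R / 2 ^ Suc j \<le> d)"
  have 1: "R / 2 ^ Suc j \<le> d" unfolding j_def by (rule LeastI) fact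
  moreover have "d < R / 2 ^ j"
  proof (cases j)
    case (Suc i)
    then show ?thesis using not_less_Least[of i "\<lambda>j. R / 2 ^ Suc j \<le> d"] by (simp add: j_def)
  qed (use assms in simp)
  ultimately show ?thesis using that by blast
qed

text \<open>Shell \<open>j\<close> has area at most \<open>C * (R / 2 ^ j) ^ k\<close>, and the
  integrand there is at most \<open>a j\<close>. The powers of two combine to the ratio
  \<open>2 powr (-1/2)\<close>, so the bounds \<open>t j\<close> form a convergent geometric series
  whose sum does not depend on the centre.\<close>

lemma weakly_singular_integral:
  fixes S :: "'a::euclidean_space set"
  assumes S: "upper_regular S C" and R: "0 < R" and k: "k = DIM('a) - 1" "k \<ge> 1"
  obtains K where "0 \<le> K" "\<And>x. S \<subseteq> ball x R \<Longrightarrow>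
    (\<integral>\<^sup>+y. ennreal (norm (x - y) powr (1/2 - k)) \<partial>surface_measure S) \<le> ennreal K"
proof -
  let ?\<mu> = "surface_measure S"
  define a where "a j = (R / 2 ^ Suc j) powr (1/2 - k)" for j :: nat
  define t where "t j = a j * (C * (R / 2 ^ j) ^ k)" for j
  define q :: real where "q = 2 powr (-1/2)"
  have q: "0 < q" "q < 1" by (auto simp: q_def powr_less_one)
  have C: "0 \<le> C" using S by (simp add: upper_regular_def)
  have t: "t j = C * R powr (1/2) * 2 powr (k - 1/2) * q ^ j" for j
  proof -
    have "a j = (R / 2 powr (j + 1)) powr (1/2 - k)"
      by (simp add: a_def powr_add powr_realpow)
    also have "\<dots> = R powr (1/2 - k) * 2 powr (- ((j + 1) * (1/2 - k)))"
      using R by (simp only: powr_divide powr_powr powr_minus_divide) simp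
    finally have 1: "a j = R powr (1/2 - k) * 2 powr (- ((j + 1) * (1/2 - k)))" .
    have 2: "(R / 2 ^ j) ^ k = R powr k * 2 powr (- (real j * k))"
    proof -
      have "2 powr (- (real j * k)) = 1 / (2::real) ^ (j * k)"
        by (metis of_nat_mult powr_minus_divide powr_realpow zero_less_numeral)
      then show ?thesis using R by (simp add: powr_realpow power_divide power_mult)
    qed
    have "t j = C * (R powr (1/2 - k) * R powr k) * (2 powr (- ((j + 1) * (1/2 - k))) * 2 powr (- (real j * k)))"
      by (simp add: t_def 1 2)
    also have "R powr (1/2 - k) * R powr k = R powr (1/2)" by (simp flip: powr_add)
    also have "2 powr (- ((j + 1) * (1/2 - k))) * 2 powr (- (real j * k)) =
        (2::real) powr ((k - 1/2) + (-1/2) * j)"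
      unfolding powr_add[symmetric] by (simp add: algebra_simps add_divide_distrib)
    also have "\<dots> = 2 powr (k - 1/2) * q ^ j"
      using q(1) by (simp only: powr_add powr_powr[symmetric] q_def[symmetric] powr_realpow)
    finally show ?thesis by simp
  qed
  have t0: "0 \<le> t j" for j using C q by (simp add: t)
  have sum: "summable t" unfolding t using q by (intro summable_mult summable_geometric) auto
  show ?thesis
  proof (rule that)
    show "0 \<le> suminf t" using sum t0 by (rule suminf_nonneg)
    fix x assume x: "S \<subseteq> ball x R"
    have [measurable]: "S \<inter> ball x \<rho> \<in> sets ?\<mu>" for \<rho>
      unfolding sets_surface_measure by (auto simp: sets_restrict_space)
    have "(\<integral>\<^sup>+y. ennreal (norm (x - y) powr (1/2 - k)) \<partial>?\<mu>) \<le>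
        (\<integral>\<^sup>+y. (\<Sum>j. ennreal (a j) * indicator (S \<inter> ball x (R / 2 ^ j)) y) \<partial>?\<mu>)"
    proof (intro nn_integral_mono)
      fix y assume "y \<in> space ?\<mu>"
      then have y: "y \<in> S" by simp
      show "ennreal (norm (x - y) powr (1/2 - k)) \<le> (\<Sum>j. ennreal (a j) * indicator (S \<inter> ball x (R / 2 ^ j)) y)"
      \<comment> \<open>At \<open>y = x\<close> the integrand is \<open>0\<close>, the value of
        \<open>powr\<close> at base \<open>0\<close>; elsewhere the single term of the shell
        containing \<open>y\<close> already dominates.\<close>
      proof (cases "y = x")
        case False
        then have "0 < norm (x - y)" "norm (x - y) < R" using x y by (auto simp: dist_norm subset_iff)
        then obtain j where j: "norm (x - y) < R / 2 ^ j" "R / 2 ^ Suc j \<le> norm (x - y)"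
          by (rule dyadic_shell)
        have "ennreal (norm (x - y) powr (1/2 - k)) \<le> ennreal (a j)"
          unfolding a_def using j R k(2) by (intro ennreal_leI powr_mono2') auto
        also have "\<dots> = ennreal (a j) * indicator (S \<inter> ball x (R / 2 ^ j)) y"
          using j y by (simp add: dist_norm)
        also have "\<dots> \<le> (\<Sum>i. ennreal (a i) * indicator (S \<inter> ball x (R / 2 ^ i)) y)"
          using sum_le_suminf[of "\<lambda>i. ennreal (a i) * indicator (S \<inter> ball x (R / 2 ^ i)) y" "{j}"]
          by (simp del: sum_mult_indicator)
        finally show ?thesis .
      qed simp
    qed
    also have "\<dots> = (\<Sum>j. \<integral>\<^sup>+y. ennreal (a j) * indicator (S \<inter> ball x (R / 2 ^ j)) y \<partial>?\<mu>)"
      by (rule nn_integral_suminf) measurable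
    also have "\<dots> = (\<Sum>j. ennreal (a j) * emeasure ?\<mu> (S \<inter> ball x (R / 2 ^ j)))"
      by (simp add: nn_integral_cmult_indicator)
    also have "\<dots> \<le> (\<Sum>j. ennreal (t j))"
    proof (intro suminf_le)
      fix j
      have "emeasure ?\<mu> (S \<inter> ball x (R / 2 ^ j)) \<le> ennreal (C * (R / 2 ^ j) ^ k)"
        using S R unfolding upper_regular_def k(1) by simp
      then have "ennreal (a j) * emeasure ?\<mu> (S \<inter> ball x (R / 2 ^ j)) \<le>
          ennreal (a j) * ennreal (C * (R / 2 ^ j) ^ k)"
        by (rule mult_left_mono) simp
      then show "ennreal (a j) * emeasure ?\<mu> (S \<inter> ball x (R / 2 ^ j)) \<le> ennreal (t j)"
        by (simp add: t_def a_def ennreal_mult')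
    qed auto
    also have "\<dots> = ennreal (suminf t)" using sum t0 by (rule suminf_ennreal2[rotated])
    finally show "(\<integral>\<^sup>+y. ennreal (norm (x - y) powr (1/2 - k)) \<partial>?\<mu>) \<le> ennreal (suminf t)" .
  qed
qed

lemma finite_surface_measure:
  assumes "upper_regular S C" "bounded S"
  shows "finite_measure (surface_measure S)"
proof
  obtain r where "0 < r" "S \<subseteq> ball 0 r" using bounded_subset_ballD[OF assms(2), of 0] by auto
  then have "emeasure (surface_measure S) S \<le> ennreal (C * r ^ (DIM('a) - 1))"
    using assms(1) unfolding upper_regular_def by (metis inf.absorb1)
  then show "emeasure (surface_measure S) (space (surface_measure S)) \<noteq> \<infinity>"
    by (auto simp: top_unique)
qed

section \<open>Normals, quadratic estimate and area within one graph chart\<close>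

section \<open>Charts of a boundary\<close>

text \<open>One constant \<open>L\<close> serves as bound and as Lipschitz constant of the gradient,
  on the closed ball about the projection of \<open>x0\<close>. This ball is convex, as the mean
  value arguments require, and contains the projection of \<open>ball x0 r\<close>.\<close>

locale boundary_chart =
  fixes \<Omega> :: "'a::euclidean_space set" and x0 e :: 'a and r L :: real
    and \<gamma> :: "'a \<Rightarrow> real" and g :: "'a \<Rightarrow> 'a"
  assumes open_region: "open \<Omega>" and r: "0 < r" and e: "norm e = 1" and L: "0 \<le> L"
    and chart: "\<Omega> \<inter> ball x0 r = {x \<in> ball x0 r. \<gamma> (x - (x \<bullet> e) *\<^sub>R e) < x \<bullet> e}"
    and grad: "\<And>u. GDERIV \<gamma> u :> g u"
    and grad_bound: "\<And>u. u \<in> cball (x0 - (x0 \<bullet> e) *\<^sub>R e) r \<Longrightarrow> norm (g u) \<le> L"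
    and grad_lipschitz: "\<And>u v. u \<in> cball (x0 - (x0 \<bullet> e) *\<^sub>R e) r \<Longrightarrow>
      v \<in> cball (x0 - (x0 \<bullet> e) *\<^sub>R e) r \<Longrightarrow> norm (g u - g v) \<le> L * norm (u - v)"
begin

definition proj :: "'a \<Rightarrow> 'a" where "proj z = z - (z \<bullet> e) *\<^sub>R e"

text \<open>A defining function of the region inside the chart ball: negative in the region, zero on
  its boundary.\<close>

definition level :: "'a \<Rightarrow> real" where "level z = \<gamma> (proj z) - z \<bullet> e"

text \<open>The gradient of \<open>level\<close>, not normalised; \<open>g\<close> is projected
  because \<open>level\<close> sees \<gamma> only through \<open>proj\<close>.\<close>

definition normal :: "'a \<Rightarrow> 'a" where "normal x = proj (g (proj x)) - e"

lemma e_e [simp]: "e \<bullet> e = 1"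
  using e by (simp add: norm_eq_1)

lemma proj_e [simp]: "proj z \<bullet> e = 0"
  by (simp add: proj_def inner_diff_left)

lemma proj_add: "proj (z + w) = proj z + proj w"
  and proj_diff: "proj (z - w) = proj z - proj w"
  and proj_scaleR: "proj (t *\<^sub>R z) = t *\<^sub>R proj z"
  by (simp_all add: proj_def inner_add_left inner_diff_left algebra_simps)

lemma proj_basis [simp]: "proj e = 0"
  by (simp add: proj_def)

lemma proj_orthogonal: "q \<bullet> e = 0 \<Longrightarrow> proj q = q"
  by (simp add: proj_def)

lemma proj_symmetric: "proj z \<bullet> w = z \<bullet> proj w"
  by (simp add: proj_def inner_diff_left inner_diff_right inner_commute)

lemma decompose: "z = proj z + (z \<bullet> e) *\<^sub>R e"
  by (simp add: proj_def)

lemma norm_proj_le: "norm (proj z) \<le> norm z"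
proof -
  have "proj z \<bullet> proj z = z \<bullet> z - (z \<bullet> e) * (z \<bullet> e)"
    by (simp add: proj_def inner_diff_left inner_diff_right inner_commute)
  then show ?thesis by (simp add: norm_le)
qed

lemma proj_ball: "z \<in> ball x0 r \<Longrightarrow> proj z \<in> cball (x0 - (x0 \<bullet> e) *\<^sub>R e) r"
  using norm_proj_le[of "x0 - z"] by (simp add: dist_norm proj_diff) (simp add: proj_def)

lemma bounded_linear_proj: "bounded_linear proj"
  unfolding proj_def by (intro bounded_linear_intros)

lemma level_derivative: "(level has_derivative (\<lambda>h. h \<bullet> normal x)) (at x)"
proof -
  have 1: "(\<gamma> has_derivative (\<lambda>h. h \<bullet> g (proj x))) (at (proj x))"
    using grad[of "proj x"] by (simp add: gderiv_def)
  have 2: "(proj has_derivative proj) (at x)"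
    by (rule bounded_linear_imp_has_derivative[OF bounded_linear_proj])
  have "(level has_derivative (\<lambda>h. proj h \<bullet> g (proj x) - h \<bullet> e)) (at x)"
    unfolding level_def by (intro derivative_intros has_derivative_compose[OF 2 1])
  then show ?thesis by (simp add: normal_def inner_diff_right proj_symmetric)
qed

lemma continuous_level: "continuous_on A level"
  by (meson level_derivative has_derivative_continuous continuous_at_imp_continuous_on)

lemma mem_region_iff: "z \<in> ball x0 r \<Longrightarrow> z \<in> \<Omega> \<longleftrightarrow> level z < 0"
  using chart unfolding level_def proj_def by (auto simp: set_eq_iff)

text \<open>A positive level persists on a neighbourhood, which then misses the region. At level
  zero, moving along \<open>e\<close> lowers the level at unit rate and so enters the region at
  arbitrarily small distance.\<close>

lemma frontier_iff:
  assumes z: "z \<in> ball x0 r"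
  shows "z \<in> frontier \<Omega> \<longleftrightarrow> level z = 0"
proof
  assume f: "z \<in> frontier \<Omega>"
  then have "z \<notin> \<Omega>" using open_region frontier_disjoint_eq by blast
  then have "level z \<ge> 0" using mem_region_iff[OF z] by simp
  moreover have "\<not> 0 < level z"
  proof
    assume pos: "0 < level z"
    let ?V = "ball x0 r \<inter> {w. 0 < level w}"
    have "open ?V" by (intro open_Int open_ball open_Collect_less continuous_on_const continuous_level)
    moreover have "?V \<inter> \<Omega> = {}" using mem_region_iff by auto
    ultimately have "?V \<inter> closure \<Omega> = {}" by (simp add: open_Int_closure_eq_empty)
    then show False using z pos f by (auto simp: frontier_def)
  qed
  ultimately show "level z = 0" by simp
next
  assume 0: "level z = 0"
  then have "z \<notin> \<Omega>" using mem_region_iff[OF z] by simp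
  moreover have "z \<in> closure \<Omega>" unfolding closure_approachable
  proof (intro allI impI)
    fix \<epsilon> :: real assume \<epsilon>: "0 < \<epsilon>"
    define t where "t = min \<epsilon> (r - dist x0 z) / 2"
    have t: "0 < t" "t < \<epsilon>" "t < r - dist x0 z" using \<epsilon> z by (auto simp: t_def)
    have d: "dist (z + t *\<^sub>R e) z = t" using t e by (simp add: dist_norm)
    have "z + t *\<^sub>R e \<in> ball x0 r"
      using dist_triangle[of x0 "z + t *\<^sub>R e" z] d t by (simp add: dist_commute)
    moreover have "level (z + t *\<^sub>R e) = - t"
      using 0 by (simp add: level_def proj_add proj_scaleR inner_add_left)
    ultimately show "\<exists>y\<in>\<Omega>. dist y z < \<epsilon>" using mem_region_iff d t by (metis neg_less_0_iff_less)
  qed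
  ultimately show "z \<in> frontier \<Omega>" using open_region by (simp add: frontier_def interior_open)
qed

lemma normal_e: "normal x \<bullet> e = - 1"
  by (simp add: normal_def inner_diff_left)

text \<open>The component along \<open>e\<close> is \<open>- 1\<close>. Hence normalising can only
  shrink inner products with this vector.\<close>

lemma norm_normal: "1 \<le> norm (normal x)"
  using Cauchy_Schwarz_ineq2[of "normal x" e] by (simp add: normal_e e)

lemma normal_nonzero [simp]: "normal x \<noteq> 0"
  using norm_normal[of x] by auto

text \<open>On the surface the height equals \<gamma> of the projection, so the inner product is
  minus the first-order Taylor remainder of \<gamma>, which is quadratic because the gradient is
  Lipschitz.\<close>

lemma surface_quadratic:
  assumes x: "x \<in> ball x0 r" "x \<in> frontier \<Omega>" and y: "y \<in> ball x0 r" "y \<in> frontier \<Omega>"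
  shows "\<bar>(y - x) \<bullet> normal x\<bar> \<le> L * (norm (y - x))\<^sup>2"
proof -
  let ?a = "proj x" and ?b = "proj y" and ?S = "closed_segment (proj x) (proj y)"
  have ab: "?a \<in> cball (x0 - (x0 \<bullet> e) *\<^sub>R e) r" "?b \<in> cball (x0 - (x0 \<bullet> e) *\<^sub>R e) r"
    using proj_ball x(1) y(1) by blast+
  then have S: "?S \<subseteq> cball (x0 - (x0 \<bullet> e) *\<^sub>R e) r" by (simp add: closed_segment_subset)
  have "norm (\<gamma> ?b - \<gamma> ?a - (?b - ?a) \<bullet> g ?a) \<le> norm (?b - ?a) * (L * norm (?b - ?a))"
  proof (rule differentiable_bound_linearization[where S = ?S and f' = "\<lambda>u h. h \<bullet> g u"])
    show "?a + t *\<^sub>R (?b - ?a) \<in> ?S" if "t \<in> {0..1}" for t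
      using that by (auto simp: closed_segment_def algebra_simps intro!: exI[of _ t])
    show "(\<gamma> has_derivative (\<lambda>h. h \<bullet> g u)) (at u within ?S)" for u
      using grad[of u] has_derivative_at_withinI by (auto simp: gderiv_def)
    show "onorm ((\<lambda>h. h \<bullet> g u) - (\<lambda>h. h \<bullet> g ?a)) \<le> L * norm (?b - ?a)"
      if u: "u \<in> ?S" for u
    proof (rule onorm_le)
      fix h
      have "norm (((\<lambda>h. h \<bullet> g u) - (\<lambda>h. h \<bullet> g ?a)) h) \<le> norm h * norm (g u - g ?a)"
        using Cauchy_Schwarz_ineq2[of h "g u - g ?a"] by (simp add: inner_diff_right)
      also have "\<dots> \<le> norm h * (L * norm (?b - ?a))"
        using grad_lipschitz[of u ?a] S u ab L segment_bound(1)[OF u]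
        by (meson mult_left_mono norm_ge_zero order_trans subsetD)
      finally show "norm (((\<lambda>h. h \<bullet> g u) - (\<lambda>h. h \<bullet> g ?a)) h) \<le> L * norm (?b - ?a) * norm h"
        by (simp only: mult_ac)
    qed
  qed simp
  moreover have "(y - x) \<bullet> normal x = - (\<gamma> ?b - \<gamma> ?a - (?b - ?a) \<bullet> g ?a)"
  proof -
    have "\<gamma> ?a = x \<bullet> e" "\<gamma> ?b = y \<bullet> e" using x y frontier_iff by (auto simp: level_def)
    then show ?thesis
      by (simp add: normal_def inner_diff_right inner_diff_left proj_symmetric[symmetric] proj_diff)
  qed
  moreover have "norm (?b - ?a) * (L * norm (?b - ?a)) \<le> L * (norm (y - x))\<^sup>2"
    using norm_proj_le[of "y - x"] L
    by (simp add: proj_diff power2_eq_square mult.left_commute mult_left_mono mult_mono)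
  ultimately show ?thesis by simp
qed

text \<open>The definite description needs existence and uniqueness. For existence,
  \<open>level\<close> vanishes along curves in the frontier near \<open>x\<close> and has positive
  derivative in direction \<open>?n\<close>. For uniqueness, curves in the graph determine a
  competitor up to sign, and the side condition settles the sign.\<close>

lemma outward_normal_eq:
  assumes x: "x \<in> ball x0 r" "x \<in> frontier \<Omega>"
  shows "outward_normal \<Omega> x = normal x /\<^sub>R norm (normal x)"
  unfolding outward_normal_def
proof (rule the_equality)
  let ?n = "normal x /\<^sub>R norm (normal x)"
  have pos: "0 < norm (normal x)" by simp
  have x0: "level x = 0" using x frontier_iff by blast
  have inball: "\<exists>d>0. \<forall>t. \<bar>t\<bar> < d \<longrightarrow> x + t *\<^sub>R v \<in> ball x0 r" if "norm v = 1" for v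
  proof (intro exI[of _ "r - dist x0 x"] conjI allI impI)
    show "0 < r - dist x0 x" using x by simp
    fix t assume t: "\<bar>t\<bar> < r - dist x0 x"
    have "dist x (x + t *\<^sub>R v) = \<bar>t\<bar>" using that by (simp add: dist_norm)
    then show "x + t *\<^sub>R v \<in> ball x0 r"
      using t dist_triangle[of x0 "x + t *\<^sub>R v" x] by (simp add: mem_ball)
  qed
  have n1: "norm ?n = 1" using pos by simp
  have nn: "?n \<bullet> normal x = norm (normal x)"
    using pos by (simp add: power2_norm_eq_inner[symmetric] power2_eq_square)
  have line: "((\<lambda>t. level (x + t *\<^sub>R v)) has_real_derivative (v \<bullet> normal x)) (at 0)" for v
  proof -
    have "((\<lambda>t. x + t *\<^sub>R v) has_derivative (\<lambda>t. t *\<^sub>R v)) (at 0)"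
      by (auto intro!: derivative_eq_intros)
    from has_derivative_compose[OF this, of level "\<lambda>h. h \<bullet> normal x"] level_derivative[of x]
    show ?thesis by (simp add: has_field_derivative_def mult_commute_abs)
  qed
  obtain d1 where d1: "d1 > 0" "\<And>t. \<bar>t\<bar> < d1 \<Longrightarrow> x + t *\<^sub>R ?n \<in> ball x0 r" using inball[OF n1] by auto
  obtain d2 where d2: "d2 > 0" "\<And>t. t > 0 \<Longrightarrow> t < d2 \<Longrightarrow> 0 < level (x + t *\<^sub>R ?n)"
    using DERIV_pos_inc_right[OF line[of ?n]] pos x0 by (auto simp: nn simp del: inner_scaleR_left)
  have "- ?n \<bullet> normal x < 0" using nn pos by (simp del: inner_scaleR_left)
  from DERIV_neg_dec_right[OF line this]
  obtain d3 where d3: "d3 > 0" "\<And>t. t > 0 \<Longrightarrow> t < d3 \<Longrightarrow> level (x - t *\<^sub>R ?n) < 0"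
    using x0 by auto
  show n: "norm ?n = 1 \<and>
    (\<forall>c w. c 0 = x \<and> range c \<subseteq> frontier \<Omega> \<and> (c has_vector_derivative w) (at (0::real)) \<longrightarrow> ?n \<bullet> w = 0) \<and>
    (\<exists>\<epsilon>>0. \<forall>t\<in>{0<..<\<epsilon>}. x + t *\<^sub>R ?n \<notin> \<Omega> \<and> x - t *\<^sub>R ?n \<in> \<Omega>)"
  proof (intro conjI allI impI)
    show "norm ?n = 1" by (rule n1)
  next
    fix c :: "real \<Rightarrow> 'a" and w
    assume c: "c 0 = x \<and> range c \<subseteq> frontier \<Omega> \<and> (c has_vector_derivative w) (at 0)"
    then have dc: "(c has_derivative (\<lambda>t. t *\<^sub>R w)) (at 0)" by (simp add: has_vector_derivative_def)
    have "((\<lambda>t. level (c t)) has_derivative (\<lambda>t. (t *\<^sub>R w) \<bullet> normal x)) (at 0)"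
      using has_derivative_compose[OF dc, of level "\<lambda>h. h \<bullet> normal x"] level_derivative[of x] c by simp
    \<comment> \<open>Level zero on the frontier is known only in the chart ball, which contains the
      curve for parameters near \<open>0\<close>.\<close>
    moreover have "((\<lambda>t. level (c t)) has_derivative (\<lambda>t. 0)) (at 0)"
    proof (rule has_derivative_transform_eventually[OF has_derivative_const[of 0]])
      have "isCont c 0" using dc has_derivative_continuous by blast
      then have "\<forall>\<^sub>F t in at 0. c t \<in> ball x0 r"
        using topological_tendstoD[of c "c 0" "at 0" "ball x0 r"] x c by (simp add: isCont_def)
      then show "\<forall>\<^sub>F t in at 0. 0 = level (c t)"
        by eventually_elim (use c frontier_iff in \<open>auto simp: subset_iff\<close>)
    qed (use x0 c in auto)
    ultimately have "(\<lambda>t. (t *\<^sub>R w) \<bullet> normal x) = (\<lambda>t. 0)" by (rule has_derivative_unique)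
    from fun_cong[OF this, of 1] show "?n \<bullet> w = 0" by (simp add: inner_commute)
  next
    show "\<exists>\<epsilon>>0. \<forall>t\<in>{0<..<\<epsilon>}. x + t *\<^sub>R ?n \<notin> \<Omega> \<and> x - t *\<^sub>R ?n \<in> \<Omega>"
    proof (intro exI[of _ "min d1 (min d2 d3)"] conjI ballI)
      fix t assume t: "t \<in> {0<..<min d1 (min d2 d3)}"
      then show "x + t *\<^sub>R ?n \<notin> \<Omega>" using d1(2)[of t] d2(2)[of t] mem_region_iff by fastforce
      show "x - t *\<^sub>R ?n \<in> \<Omega>" using t d1(2)[of "- t"] d3(2)[of t] mem_region_iff by fastforce
    qed (use d1 d2 d3 in auto)
  qed
  fix v assume v: "norm v = 1 \<and>
    (\<forall>c w. c 0 = x \<and> range c \<subseteq> frontier \<Omega> \<and> (c has_vector_derivative w) (at (0::real)) \<longrightarrow> v \<bullet> w = 0) \<and>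
    (\<exists>\<epsilon>>0. \<forall>t\<in>{0<..<\<epsilon>}. x + t *\<^sub>R v \<notin> \<Omega> \<and> x - t *\<^sub>R v \<in> \<Omega>)"
  have tangent: "v \<bullet> (q + (q \<bullet> g (proj x)) *\<^sub>R e) = 0" if q: "q \<bullet> e = 0" for q
  proof -
    define z where "z t = proj x + t *\<^sub>R q + \<gamma> (proj x + t *\<^sub>R q) *\<^sub>R e" for t
    \<comment> \<open>The description quantifies over curves that stay in the frontier for all
      times. The graph curve \<open>z\<close> is therefore replaced by the point \<open>x\<close>
      whenever it leaves the chart ball, which changes nothing near \<open>0\<close>.\<close>
    define c where "c t = (if z t \<in> ball x0 r then z t else x)" for t
    have z0: "z 0 = x" using x0 decompose[of x] by (simp add: z_def level_def)
    have projz: "proj (z t) = proj x + t *\<^sub>R q" for t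
      using q by (simp add: z_def proj_add proj_scaleR proj_orthogonal)
    have "level (z t) = 0" for t
      unfolding level_def projz using q by (simp add: z_def inner_add_left)
    then have "range c \<subseteq> frontier \<Omega>" using frontier_iff x by (auto simp: c_def)
    moreover have "c 0 = x" by (simp add: c_def z0)
    moreover have "(c has_vector_derivative (q + (q \<bullet> g (proj x)) *\<^sub>R e)) (at 0)"
    proof -
      have "((\<lambda>t. proj x + t *\<^sub>R q) has_derivative (\<lambda>t. t *\<^sub>R q)) (at 0)"
        by (auto intro!: derivative_eq_intros)
      from has_derivative_compose[OF this, of \<gamma> "\<lambda>h. h \<bullet> g (proj x)"] grad[of "proj x"]
      have "((\<lambda>t. \<gamma> (proj x + t *\<^sub>R q)) has_derivative (\<lambda>t. (t *\<^sub>R q) \<bullet> g (proj x))) (at 0)"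
        by (simp add: gderiv_def)
      then have "(z has_derivative (\<lambda>t. t *\<^sub>R (q + (q \<bullet> g (proj x)) *\<^sub>R e))) (at 0)"
        unfolding z_def by (auto intro!: derivative_eq_intros simp: algebra_simps)
      then have dz: "(z has_vector_derivative (q + (q \<bullet> g (proj x)) *\<^sub>R e)) (at 0)"
        by (simp add: has_vector_derivative_def)
      then have "isCont z 0" by (rule has_vector_derivative_continuous)
      then have "\<forall>\<^sub>F t in at 0. z t \<in> ball x0 r"
        using topological_tendstoD[of z "z 0" "at 0" "ball x0 r"] x z0 by (simp add: isCont_def)
      then have "\<forall>\<^sub>F t in at 0. z t = c t" by eventually_elim (simp add: c_def)
      moreover have "z 0 = c 0" by (simp add: c_def z0)
      ultimately show ?thesis
        using dz has_derivative_transform_eventually[of z _ 0 UNIV c]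
        by (simp add: has_vector_derivative_def)
    qed
    ultimately show ?thesis using v by blast
  qed
  define s where "s = v \<bullet> e"
  \<comment> \<open>By \<open>tangent\<close>, \<open>?u\<close> is orthogonal to the whole
    hyperplane, so its projection vanishes and \<open>v\<close> is a multiple of
    \<open>normal x\<close>.\<close>
  let ?u = "v + s *\<^sub>R g (proj x)"
  have "?u \<bullet> q = 0" if "q \<bullet> e = 0" for q
    using tangent[OF that] by (simp add: inner_add_left inner_add_right s_def inner_commute mult.commute)
  from this[of "proj ?u"] have "proj ?u \<bullet> proj ?u = 0"
    by (simp add: proj_symmetric proj_orthogonal)
  then have "proj v = - s *\<^sub>R proj (g (proj x))"
    by (simp add: proj_add proj_scaleR eq_neg_iff_add_eq_0)
  then have vs: "v = (- s) *\<^sub>R normal x"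
    using decompose[of v] by (simp add: normal_def s_def algebra_simps)
  then have s1: "\<bar>s\<bar> * norm (normal x) = 1" using v by (metis abs_minus_cancel norm_scaleR)
  show "v = ?n"
  proof (cases "s \<le> 0")
    case True
    then have "- s = inverse (norm (normal x))" using s1 pos by (simp add: field_simps)
    then show ?thesis using vs by simp
  next
    case False
    then have "s = inverse (norm (normal x))" using s1 pos by (simp add: field_simps)
    then have vn: "v = - ?n" using vs by simp
    \<comment> \<open>For small \<open>t\<close> the point \<open>x - t *\<^sub>R ?n\<close> would
      lie both outside and inside the region.\<close>
    obtain \<epsilon> where \<epsilon>: "\<epsilon> > 0" "\<And>t. t \<in> {0<..<\<epsilon>} \<Longrightarrow> x + t *\<^sub>R v \<notin> \<Omega>" using v by blast
    obtain \<epsilon>' where \<epsilon>': "\<epsilon>' > 0" "\<And>t. t \<in> {0<..<\<epsilon>'} \<Longrightarrow> x - t *\<^sub>R ?n \<in> \<Omega>" using n by blast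
    define t where "t = min \<epsilon> \<epsilon>' / 2"
    have "t \<in> {0<..<\<epsilon>}" "t \<in> {0<..<\<epsilon>'}" using \<epsilon>(1) \<epsilon>'(1) by (auto simp: t_def)
    then show ?thesis using \<epsilon>(2)[of t] \<epsilon>'(2)[of t] vn by simp
  qed
qed

lemma norm_outward_normal: "x \<in> ball x0 r \<Longrightarrow> x \<in> frontier \<Omega> \<Longrightarrow> norm (outward_normal \<Omega> x) = 1"
  by (simp add: outward_normal_eq)

lemma continuous_outward_normal: "continuous_on (frontier \<Omega> \<inter> ball x0 r) (outward_normal \<Omega>)"
proof -
  have "L-lipschitz_on (cball (x0 - (x0 \<bullet> e) *\<^sub>R e) r) g"
    using grad_lipschitz L by (intro lipschitz_onI) (auto simp: dist_norm)
  then have g: "continuous_on (cball (x0 - (x0 \<bullet> e) *\<^sub>R e) r) g" by (rule lipschitz_on_continuous_on)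
  have p: "continuous_on A proj" for A
    using bounded_linear_proj by (rule linear_continuous_on)
  have "continuous_on (ball x0 r) (\<lambda>x. g (proj x))"
    by (rule continuous_on_compose2[OF g p]) (use proj_ball in blast)
  then have "continuous_on (ball x0 r) normal"
    unfolding normal_def using continuous_on_compose2[OF p[of UNIV]] by (intro continuous_intros) auto
  then have "continuous_on (ball x0 r) (\<lambda>x. normal x /\<^sub>R norm (normal x))"
    by (intro continuous_intros) auto
  then have "continuous_on (frontier \<Omega> \<inter> ball x0 r) (\<lambda>x. normal x /\<^sub>R norm (normal x))"
    by (rule continuous_on_subset) auto
  then show ?thesis
    by (rule continuous_on_eq) (auto simp: outward_normal_eq)
qed

text \<open>Here \<open>y\<close> ranges over the entire frontier. Inside the chart ball
  \<open>surface_quadratic\<close> applies; outside it the two points are at least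
  \<open>r / 2\<close> apart and Cauchy-Schwarz suffices, whence the constant
  \<open>max L (2 / r)\<close>.\<close>

lemma normal_quadratic_local:
  obtains C \<rho> where "0 \<le> C" "0 < \<rho>" "\<And>x y. x \<in> frontier \<Omega> \<inter> ball x0 \<rho> \<Longrightarrow> y \<in> frontier \<Omega> \<Longrightarrow>
    \<bar>(x - y) \<bullet> outward_normal \<Omega> x\<bar> \<le> C * (norm (x - y))\<^sup>2"
proof (rule that[of "max L (2 / r)" "r / 2"])
  fix x y assume x: "x \<in> frontier \<Omega> \<inter> ball x0 (r / 2)" and y: "y \<in> frontier \<Omega>"
  have xb: "x \<in> ball x0 r" using x r by auto
  show "\<bar>(x - y) \<bullet> outward_normal \<Omega> x\<bar> \<le> max L (2 / r) * (norm (x - y))\<^sup>2"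
  proof (cases "y \<in> ball x0 r")
    case True
    have "\<bar>(x - y) \<bullet> outward_normal \<Omega> x\<bar> = \<bar>(y - x) \<bullet> normal x\<bar> / norm (normal x)"
    proof -
      have "(x - y) \<bullet> outward_normal \<Omega> x = - ((y - x) \<bullet> normal x) / norm (normal x)"
      proof -
        have "(x - y) \<bullet> outward_normal \<Omega> x = - ((y - x) \<bullet> outward_normal \<Omega> x)"
          by (simp add: inner_diff_left)
        also have "(y - x) \<bullet> outward_normal \<Omega> x = ((y - x) \<bullet> normal x) / norm (normal x)"
          using x xb by (simp only: outward_normal_eq Int_iff inner_scaleR_right divide_inverse mult.commute)
        finally show ?thesis by simp
      qed
      then show ?thesis by (simp only: abs_divide abs_minus_cancel abs_norm_cancel)
    qed
    also have "\<dots> \<le> \<bar>(y - x) \<bullet> normal x\<bar>"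
      using norm_normal[of x] mult_left_mono[of 1 "norm (normal x)" "\<bar>(y - x) \<bullet> normal x\<bar>"]
      by (simp add: divide_le_eq)
    also have "\<dots> \<le> L * (norm (y - x))\<^sup>2"
      using surface_quadratic[of x y] x xb y True by auto
    also have "\<dots> \<le> max L (2 / r) * (norm (x - y))\<^sup>2"
      by (simp add: norm_minus_commute mult_right_mono)
    finally show ?thesis .
  next
    case False
    then have "r / 2 \<le> norm (x - y)"
      using x dist_triangle[of x0 y x] by (simp add: dist_norm)
    then have "1 \<le> (2 / r) * norm (x - y)" using r by (simp add: field_simps)
    from mult_right_mono[OF this norm_ge_zero[of "x - y"]]
    have "norm (x - y) \<le> (2 / r) * norm (x - y) * norm (x - y)" by simp
    moreover have "\<bar>(x - y) \<bullet> outward_normal \<Omega> x\<bar> \<le> norm (x - y)"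
      using Cauchy_Schwarz_ineq2[of "x - y" "outward_normal \<Omega> x"] norm_outward_normal[OF xb] x by simp
    moreover have "(2 / r) * norm (x - y) * norm (x - y) \<le> max L (2 / r) * (norm (x - y))\<^sup>2"
      unfolding power2_eq_square mult.assoc by (rule mult_right_mono) auto
    ultimately show ?thesis by linarith
  qed
qed (use L r in auto)

text \<open>The piece is a Lipschitz graph over the hyperplane orthogonal to \<open>e\<close>.
  Completing \<open>e\<close> to an orthonormal basis and dropping it leaves coordinates that
  control distances with factor \<open>1 + L\<close>, as
  \<open>hausdorff_measure_le_coordinates\<close> requires.\<close>

lemma upper_regular_local:
  assumes "DIM('a) \<ge> 2"
  obtains C where "0 \<le> C" "\<And>c s. 0 < s \<Longrightarrow>
    emeasure (hausdorff_measure (DIM('a) - 1)) (frontier \<Omega> \<inter> ball x0 r \<inter> ball c s) \<le> ennreal (C * s ^ (DIM('a) - 1))"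
proof -
  let ?k = "DIM('a) - 1"
  obtain B where B: "e \<in> B" "pairwise orthogonal B" "\<And>x. x \<in> B \<Longrightarrow> norm x = 1"
    "independent B" "card B = DIM('a)" "span B = UNIV"
    using vector_in_orthonormal_basis[OF e] by blast
  have fin: "finite B" using B(4) by (rule independent_imp_finite)
  let ?D = "B - {e}"
  have D: "finite ?D" "card ?D = ?k" using B fin by auto
  have proj_le: "norm (proj z) \<le> (\<Sum>b\<in>?D. \<bar>z \<bullet> b\<bar>)" for z
  proof -
    have "z = (\<Sum>b\<in>B. (z \<bullet> b) *\<^sub>R b)"
      using orthonormal_basis_expand[OF B(2,3) _ fin, of z] B(6) by simp
    also have "\<dots> = (z \<bullet> e) *\<^sub>R e + (\<Sum>b\<in>?D. (z \<bullet> b) *\<^sub>R b)"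
      using B(1) fin by (rule sum.remove[rotated])
    finally have "proj z = (\<Sum>b\<in>?D. (z \<bullet> b) *\<^sub>R b)"
      unfolding proj_def by (metis add_diff_cancel_left')
    moreover have "norm (\<Sum>b\<in>?D. (z \<bullet> b) *\<^sub>R b) \<le> (\<Sum>b\<in>?D. \<bar>z \<bullet> b\<bar>)"
      by (rule sum_norm_le) (use B(3) in auto)
    ultimately show ?thesis by simp
  qed
  have lip: "norm (z - w) \<le> (1 + L) * (\<Sum>b\<in>?D. \<bar>(z - w) \<bullet> b\<bar>)"
    if z: "z \<in> frontier \<Omega> \<inter> ball x0 r" and w: "w \<in> frontier \<Omega> \<inter> ball x0 r" for z w
  proof -
    have "\<bar>\<gamma> (proj z) - \<gamma> (proj w)\<bar> \<le> L * norm (proj z - proj w)"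
      unfolding real_norm_def[symmetric]
    proof (rule differentiable_bound[where f' = "\<lambda>u h. h \<bullet> g u"])
      show "convex (cball (x0 - (x0 \<bullet> e) *\<^sub>R e) r)" by simp
      show "(\<gamma> has_derivative (\<lambda>h. h \<bullet> g u)) (at u within cball (x0 - (x0 \<bullet> e) *\<^sub>R e) r)" for u
        using grad[of u] has_derivative_at_withinI by (auto simp: gderiv_def)
      show "onorm (\<lambda>h. h \<bullet> g u) \<le> L" if "u \<in> cball (x0 - (x0 \<bullet> e) *\<^sub>R e) r" for u
      proof (rule onorm_le)
        fix h
        show "norm (h \<bullet> g u) \<le> L * norm h"
          using Cauchy_Schwarz_ineq2[of h "g u"] mult_left_mono[OF grad_bound[OF that], of "norm h"]
          by (simp add: mult.commute)
      qed
    qed (use z w proj_ball in blast)+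
    moreover have "(z - w) \<bullet> e = \<gamma> (proj z) - \<gamma> (proj w)"
      using z w frontier_iff by (auto simp: level_def inner_diff_left)
    moreover have "norm (z - w) \<le> norm (proj (z - w)) + \<bar>(z - w) \<bullet> e\<bar>"
      using norm_triangle_ineq[of "proj (z - w)" "((z - w) \<bullet> e) *\<^sub>R e"] decompose[of "z - w"] e by simp
    ultimately have "norm (z - w) \<le> (1 + L) * norm (proj (z - w))"
      by (simp add: proj_diff algebra_simps)
    also have "\<dots> \<le> (1 + L) * (\<Sum>b\<in>?D. \<bar>(z - w) \<bullet> b\<bar>)"
      using L by (intro mult_left_mono proj_le) auto
    finally show ?thesis .
  qed
  show ?thesis
  proof (rule that)
    show "0 \<le> unit_ball_vol (real ?k) * ((1 + L) * ?k) ^ ?k" using L by (intro mult_nonneg_nonneg) auto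
    fix c and s :: real assume s: "0 < s"
    have "\<bar>(z - c) \<bullet> b\<bar> < s" if "z \<in> frontier \<Omega> \<inter> ball x0 r \<inter> ball c s" "b \<in> ?D" for z b
      using Cauchy_Schwarz_ineq2[of "z - c" b] that B(3)[of b] by (auto simp: dist_norm norm_minus_commute)
    then show "emeasure (hausdorff_measure ?k) (frontier \<Omega> \<inter> ball x0 r \<inter> ball c s) \<le>
        ennreal (unit_ball_vol (real ?k) * ((1 + L) * ?k) ^ ?k * s ^ ?k)"
      using assms L s by (intro hausdorff_measure_le_coordinates[OF D]) (auto intro!: lip)
  qed
qed

end

text \<open>Second derivatives are continuous, hence bounded on a compact ball; the mean value
  inequality in each component turns this into a Lipschitz bound for the gradient.\<close>

lemma C2_boundary_chart:
  fixes \<Omega> :: "'a::euclidean_space set"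
  assumes \<Omega>: "open \<Omega>" "C2_boundary \<Omega>" and x0: "x0 \<in> frontier \<Omega>"
  obtains e r L \<gamma> g where "boundary_chart \<Omega> x0 e r L \<gamma> g"
proof -
  obtain r e \<gamma> where r: "r > 0" and e: "norm e = 1" and \<gamma>: "C_k 2 \<gamma>"
    and chart: "\<Omega> \<inter> ball x0 r = {x \<in> ball x0 r. \<gamma> (x - (x \<bullet> e) *\<^sub>R e) < x \<bullet> e}"
    using \<Omega>(2) x0 unfolding C2_boundary_def boundary_of_class_def by blast
  obtain g where g: "\<And>u. GDERIV \<gamma> u :> g u" and g': "\<forall>b\<in>Basis. C_k (Suc 0) (\<lambda>u. g u \<bullet> b)"
    using \<gamma> by (auto simp: numeral_2_eq_2)
  have "\<forall>b\<in>Basis. \<exists>G. (\<forall>u. GDERIV (\<lambda>u. g u \<bullet> b) u :> G u) \<and> continuous_on UNIV G"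
  proof
    fix b :: 'a assume "b \<in> Basis"
    with g' obtain G where "\<forall>u. GDERIV (\<lambda>u. g u \<bullet> b) u :> G u" "\<forall>b'\<in>Basis. continuous_on UNIV (\<lambda>u. G u \<bullet> b')"
      unfolding C_k.simps by blast
    moreover from this(2) have "continuous_on UNIV G" by (subst continuous_on_componentwise)
    ultimately show "\<exists>G. (\<forall>u. GDERIV (\<lambda>u. g u \<bullet> b) u :> G u) \<and> continuous_on UNIV G" by blast
  qed
  from bchoice[OF this] obtain G where G: "\<And>b u. b \<in> Basis \<Longrightarrow> GDERIV (\<lambda>u. g u \<bullet> b) u :> G b u"
    and G_cont: "\<And>b. b \<in> Basis \<Longrightarrow> continuous_on UNIV (G b)" by blast
  define Z where "Z = cball (x0 - (x0 \<bullet> e) *\<^sub>R e) r"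
  have bounded_on_Z: "\<exists>B. \<forall>u\<in>Z. norm (f u) \<le> B" if "continuous_on UNIV f" for f :: "'a \<Rightarrow> 'a"
  proof -
    have "compact (f ` Z)"
      unfolding Z_def using that continuous_on_subset by (intro compact_continuous_image) auto
    from compact_imp_bounded[OF this] show ?thesis unfolding bounded_iff by blast
  qed
  have "\<forall>b\<in>Basis. \<exists>B. \<forall>u\<in>Z. norm (G b u) \<le> B" using bounded_on_Z G_cont by blast
  from bchoice[OF this] obtain B where B: "\<And>b u. b \<in> Basis \<Longrightarrow> u \<in> Z \<Longrightarrow> norm (G b u) \<le> B b" by blast
  have "continuous_on UNIV (\<lambda>u. g u \<bullet> b)" if "b \<in> Basis" for b
    using G[OF that] unfolding gderiv_def
    by (meson has_derivative_continuous continuous_at_imp_continuous_on)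
  then have "continuous_on UNIV g" by (subst continuous_on_componentwise) auto
  then obtain Bg where Bg: "\<And>u. u \<in> Z \<Longrightarrow> norm (g u) \<le> Bg" using bounded_on_Z by blast
  \<comment> \<open>The sum dominates both the gradient bound and the combined componentwise
    Lipschitz constants; absolute values make it nonnegative.\<close>
  define L where "L = \<bar>Bg\<bar> + (\<Sum>b\<in>Basis. \<bar>B b\<bar>)"
  have B0: "0 \<le> (\<Sum>b\<in>Basis. \<bar>B b\<bar>)" by (rule sum_nonneg) simp
  have lip: "norm (g u - g v) \<le> L * norm (u - v)" if uv: "u \<in> Z" "v \<in> Z" for u v
  proof -
    have "\<bar>(g u - g v) \<bullet> b\<bar> \<le> \<bar>B b\<bar> * norm (u - v)" if b: "b \<in> Basis" for b
    proof -
      have "norm (g u \<bullet> b - g v \<bullet> b) \<le> \<bar>B b\<bar> * norm (u - v)"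
      proof (rule differentiable_bound[of Z _ "\<lambda>u h. h \<bullet> G b u"])
        show "convex Z" by (simp add: Z_def)
        show "((\<lambda>u. g u \<bullet> b) has_derivative (\<lambda>h. h \<bullet> G b w)) (at w within Z)" for w
          using G[OF b, of w] has_derivative_at_withinI by (auto simp: gderiv_def)
        show "onorm (\<lambda>h. h \<bullet> G b w) \<le> \<bar>B b\<bar>" if "w \<in> Z" for w
        proof (rule onorm_le)
          fix h
          have "norm (h \<bullet> G b w) \<le> norm h * norm (G b w)"
            using Cauchy_Schwarz_ineq2[of h "G b w"] by simp
          also have "\<dots> \<le> norm h * \<bar>B b\<bar>"
            using B[OF b that] by (intro mult_left_mono) auto
          finally show "norm (h \<bullet> G b w) \<le> \<bar>B b\<bar> * norm h" by (simp only: mult.commute)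
        qed
      qed (use uv in auto)
      then show ?thesis by (simp add: inner_diff_left)
    qed
    then have "norm (g u - g v) \<le> (\<Sum>b\<in>Basis. \<bar>B b\<bar> * norm (u - v))"
      by (intro order_trans[OF norm_le_l1] sum_mono)
    also have "\<dots> = (\<Sum>b\<in>Basis. \<bar>B b\<bar>) * norm (u - v)" by (simp add: sum_distrib_right)
    also have "\<dots> \<le> L * norm (u - v)" by (intro mult_right_mono) (auto simp: L_def)
    finally show ?thesis .
  qed
  have "boundary_chart \<Omega> x0 e r L \<gamma> g"
  proof
    show "norm (g u) \<le> L" if "u \<in> cball (x0 - (x0 \<bullet> e) *\<^sub>R e) r" for u
      using Bg[of u] that B0 unfolding L_def Z_def by linarith
  qed (use \<Omega> r e chart g lip B0 in \<open>auto simp: L_def Z_def\<close>)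
  then show ?thesis by (rule that)
qed

section \<open>From charts to a whole compact boundary\<close>

section \<open>Compact boundaries of class \<open>C\<^sup>2\<close>\<close>

locale compact_C2_region =
  fixes \<Omega> :: "'a::euclidean_space set"
  assumes open_region: "open \<Omega>" and C2: "C2_boundary \<Omega>" and compact: "compact (frontier \<Omega>)"
begin

lemma norm_outward_normal:
  assumes x: "x \<in> frontier \<Omega>"
  shows "norm (outward_normal \<Omega> x) = 1"
proof -
  obtain e r L \<gamma> g where "boundary_chart \<Omega> x e r L \<gamma> g"
    using C2_boundary_chart[OF open_region C2 x] by blast
  then interpret boundary_chart \<Omega> x e r L \<gamma> g .
  show ?thesis using norm_outward_normal[of x] x r by simp
qed

lemma continuous_outward_normal: "continuous_on (frontier \<Omega>) (outward_normal \<Omega>)"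
  unfolding continuous_on_eq_continuous_within
proof
  fix x assume x: "x \<in> frontier \<Omega>"
  obtain e r L \<gamma> g where "boundary_chart \<Omega> x e r L \<gamma> g"
    using C2_boundary_chart[OF open_region C2 x] by blast
  then interpret boundary_chart \<Omega> x e r L \<gamma> g .
  have "continuous (at x within frontier \<Omega> \<inter> ball x r) (outward_normal \<Omega>)"
    using continuous_outward_normal x r by (simp add: continuous_on_eq_continuous_within)
  moreover have "at x within frontier \<Omega> = at x within frontier \<Omega> \<inter> ball x r"
    by (rule at_within_nhd[of x "ball x r"]) (use r in auto)
  ultimately show "continuous (at x within frontier \<Omega>) (outward_normal \<Omega>)" by simp
qed

text \<open>A finite subcover for \<open>x\<close> is enough, since the local estimate already
  admits every \<open>y\<close> on the frontier.\<close>

lemma normal_quadratic: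
  obtains C where "0 \<le> C" "\<And>x y. x \<in> frontier \<Omega> \<Longrightarrow> y \<in> frontier \<Omega> \<Longrightarrow>
    \<bar>(x - y) \<bullet> outward_normal \<Omega> x\<bar> \<le> C * (norm (x - y))\<^sup>2"
proof -
  have "\<exists>C \<rho>. 0 \<le> C \<and> 0 < \<rho> \<and> (\<forall>x\<in>frontier \<Omega> \<inter> ball x0 \<rho>. \<forall>y\<in>frontier \<Omega>.
      \<bar>(x - y) \<bullet> outward_normal \<Omega> x\<bar> \<le> C * (norm (x - y))\<^sup>2)" if "x0 \<in> frontier \<Omega>" for x0
    by (rule C2_boundary_chart[OF open_region C2 that], erule boundary_chart.normal_quadratic_local) blast
  then have "\<forall>x0\<in>frontier \<Omega>. \<exists>C \<rho>. 0 \<le> C \<and> 0 < \<rho> \<and> (\<forall>x\<in>frontier \<Omega> \<inter> ball x0 \<rho>. \<forall>y\<in>frontier \<Omega>.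
      \<bar>(x - y) \<bullet> outward_normal \<Omega> x\<bar> \<le> C * (norm (x - y))\<^sup>2)" by blast
  from bchoice[OF this] obtain C where "\<forall>x0\<in>frontier \<Omega>. \<exists>\<rho>. 0 \<le> C x0 \<and> 0 < \<rho> \<and>
      (\<forall>x\<in>frontier \<Omega> \<inter> ball x0 \<rho>. \<forall>y\<in>frontier \<Omega>.
      \<bar>(x - y) \<bullet> outward_normal \<Omega> x\<bar> \<le> C x0 * (norm (x - y))\<^sup>2)" by blast
  from bchoice[OF this] obtain \<rho> where C: "\<And>x0. x0 \<in> frontier \<Omega> \<Longrightarrow> 0 \<le> C x0" "\<And>x0. x0 \<in> frontier \<Omega> \<Longrightarrow> 0 < \<rho> x0"
      "\<And>x0 x y. x0 \<in> frontier \<Omega> \<Longrightarrow> x \<in> frontier \<Omega> \<Longrightarrow> x \<in> ball x0 (\<rho> x0) \<Longrightarrow> y \<in> frontier \<Omega> \<Longrightarrow>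
        \<bar>(x - y) \<bullet> outward_normal \<Omega> x\<bar> \<le> C x0 * (norm (x - y))\<^sup>2"
    by blast
  have cover: "frontier \<Omega> \<subseteq> (\<Union>x0\<in>frontier \<Omega>. ball x0 (\<rho> x0))"
    using C(2) by force
  obtain T where T: "T \<subseteq> frontier \<Omega>" "finite T" "frontier \<Omega> \<subseteq> (\<Union>x0\<in>T. ball x0 (\<rho> x0))"
    by (rule compactE_image[OF compact _ cover]) auto
  show ?thesis
  \<comment> \<open>The sum of the nonnegative local constants dominates each of them.\<close>
  proof (rule that[of "sum C T"])
    show "0 \<le> sum C T" using C(1) T(1) by (intro sum_nonneg) auto
    fix x y assume x: "x \<in> frontier \<Omega>" and y: "y \<in> frontier \<Omega>"
    obtain x0 where x0: "x0 \<in> T" "x \<in> ball x0 (\<rho> x0)" using T(3) x by blast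
    have "C x0 \<le> sum C T" using C(1) T x0 by (intro member_le_sum) auto
    then have "C x0 * (norm (x - y))\<^sup>2 \<le> sum C T * (norm (x - y))\<^sup>2" by (rule mult_right_mono) simp
    then show "\<bar>(x - y) \<bullet> outward_normal \<Omega> x\<bar> \<le> sum C T * (norm (x - y))\<^sup>2"
      using C(3)[of x0 x y] x0 T(1) x y by force
  qed
qed

text \<open>Finitely many charts cover the compact frontier, and their area bounds add up by
  subadditivity.\<close>

lemma upper_regular_frontier:
  assumes dim: "DIM('a) \<ge> 2"
  obtains C where "upper_regular (frontier \<Omega>) C"
proof -
  let ?k = "DIM('a) - 1" and ?H = "hausdorff_measure (DIM('a) - 1) :: 'a measure"
  have "\<exists>C r. 0 \<le> C \<and> 0 < r \<and> (\<forall>c s. 0 < s \<longrightarrow>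
      emeasure ?H (frontier \<Omega> \<inter> ball x0 r \<inter> ball c s) \<le> ennreal (C * s ^ ?k))"
    if x0: "x0 \<in> frontier \<Omega>" for x0
  proof -
    obtain e r L \<gamma> g where "boundary_chart \<Omega> x0 e r L \<gamma> g"
      using C2_boundary_chart[OF open_region C2 x0] by blast
    then interpret boundary_chart \<Omega> x0 e r L \<gamma> g .
    show ?thesis using upper_regular_local[OF dim] r by metis
  qed
  then obtain C r where C: "\<And>x0. x0 \<in> frontier \<Omega> \<Longrightarrow> 0 \<le> C x0" "\<And>x0. x0 \<in> frontier \<Omega> \<Longrightarrow> 0 < r x0"
      "\<And>x0 c s. x0 \<in> frontier \<Omega> \<Longrightarrow> 0 < s \<Longrightarrow>
        emeasure ?H (frontier \<Omega> \<inter> ball x0 (r x0) \<inter> ball c s) \<le> ennreal (C x0 * s ^ ?k)"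
    by metis
  have cover: "frontier \<Omega> \<subseteq> (\<Union>x0\<in>frontier \<Omega>. ball x0 (r x0))"
    using C(2) by force
  obtain T where T: "T \<subseteq> frontier \<Omega>" "finite T" "frontier \<Omega> \<subseteq> (\<Union>x0\<in>T. ball x0 (r x0))"
    by (rule compactE_image[OF compact _ cover]) auto
  have "upper_regular (frontier \<Omega>) (sum C T)"
    unfolding upper_regular_def
  proof (intro conjI allI impI)
    show "0 \<le> sum C T" using C(1) T(1) by (intro sum_nonneg) auto
    fix c and s :: real assume s: "0 < s"
    have m: "frontier \<Omega> \<inter> ball x0 (r x0) \<inter> ball c s \<in> sets ?H" for x0 by simp
    have "emeasure (surface_measure (frontier \<Omega>)) (frontier \<Omega> \<inter> ball c s) = emeasure ?H (frontier \<Omega> \<inter> ball c s)"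
      unfolding surface_measure_def by (rule emeasure_restrict_space) auto
    also have "\<dots> \<le> emeasure ?H (\<Union>x0\<in>T. frontier \<Omega> \<inter> ball x0 (r x0) \<inter> ball c s)"
      by (rule emeasure_mono[OF _ sets.finite_UN[OF T(2) m]]) (use T in auto)
    also have "\<dots> \<le> (\<Sum>x0\<in>T. emeasure ?H (frontier \<Omega> \<inter> ball x0 (r x0) \<inter> ball c s))"
      by (rule emeasure_subadditive_finite[OF T(2)]) (use m in \<open>simp add: image_subset_iff\<close>)
    also have "\<dots> \<le> (\<Sum>x0\<in>T. ennreal (C x0 * s ^ ?k))"
      using C(3) T(1) s by (intro sum_mono) auto
    also have "\<dots> = ennreal (sum C T * s ^ ?k)"
      using C(1) T(1) s by (subst sum_ennreal) (auto simp: sum_distrib_right)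
    finally show "emeasure (surface_measure (frontier \<Omega>)) (frontier \<Omega> \<inter> ball c s) \<le> ennreal (sum C T * s ^ ?k)" .
  qed
  then show ?thesis by (rule that)
qed

text \<open>The only delicate ingredient is the normal, a definite description; its continuity on
  the frontier gives measurability there.\<close>

lemma K_star_measurable:
  "(\<lambda>(y, z). K_star \<Omega> z y) \<in> borel_measurable (surface_measure S \<Otimes>\<^sub>M surface_measure (frontier \<Omega>))"
proof -
  have [measurable]: "outward_normal \<Omega> \<in> borel_measurable (surface_measure (frontier \<Omega>))"
    using borel_measurable_continuous_on_restrict[OF continuous_outward_normal]
    by (simp cong: measurable_cong_sets[OF sets_surface_measure refl])
  have [measurable]: "(\<lambda>y. y) \<in> borel_measurable (surface_measure S)" for S :: "'a set"
    using measurable_restrict_space1[of "\<lambda>y. y" borel borel S]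
    by (simp cong: measurable_cong_sets[OF sets_surface_measure refl])
  have [measurable]: "fst \<in> borel_measurable (surface_measure S \<Otimes>\<^sub>M surface_measure (frontier \<Omega>))"
    "snd \<in> borel_measurable (surface_measure S \<Otimes>\<^sub>M surface_measure (frontier \<Omega>))"
    using measurable_compose[OF measurable_fst \<open>\<And>S. (\<lambda>y. y) \<in> borel_measurable (surface_measure S)\<close>]
      measurable_compose[OF measurable_snd \<open>\<And>S. (\<lambda>y. y) \<in> borel_measurable (surface_measure S)\<close>]
    by simp_all
  show ?thesis unfolding K_star_def case_prod_beta' by measurable
qed

end

text \<open>Consecutive indices of the chain may coincide or differ. Disjoint compact frontiers have
  distance at least some \<delta> > 0, so there is no singularity and Cauchy-Schwarz gives the
  constant \<open>1 / \<delta>\<close>.\<close>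

lemma normal_quadratic_pair:
  fixes A B :: "'a::euclidean_space set"
  assumes A: "compact_C2_region A" and B: "compact_C2_region B"
    and disj: "A = B \<or> frontier A \<inter> frontier B = {}"
  obtains C where "0 \<le> C" "\<And>x y. x \<in> frontier A \<Longrightarrow> y \<in> frontier B \<Longrightarrow>
    \<bar>(x - y) \<bullet> outward_normal A x\<bar> \<le> C * (norm (x - y))\<^sup>2"
  using disj
proof
  assume "A = B"
  then show thesis using compact_C2_region.normal_quadratic[OF A] that by metis
next
  interpret A: compact_C2_region A by (rule A)
  interpret B: compact_C2_region B by (rule B)
  assume "frontier A \<inter> frontier B = {}"
  then obtain \<delta> where \<delta>: "0 < \<delta>" "\<And>x y. x \<in> frontier A \<Longrightarrow> y \<in> frontier B \<Longrightarrow> \<delta> \<le> dist x y"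
    using separate_compact_closed[OF A.compact, of "frontier B"] by auto
  show thesis
  proof (rule that)
    show "0 \<le> 1 / \<delta>" using \<delta> by simp
    fix x y assume x: "x \<in> frontier A" and y: "y \<in> frontier B"
    have "1 \<le> norm (x - y) / \<delta>" using \<delta>(2)[OF x y] \<delta>(1) by (simp add: dist_norm)
    from mult_right_mono[OF this norm_ge_zero[of "x - y"]]
    have "norm (x - y) \<le> 1 / \<delta> * (norm (x - y))\<^sup>2" by (simp add: power2_eq_square)
    moreover have "\<bar>(x - y) \<bullet> outward_normal A x\<bar> \<le> norm (x - y)"
      using Cauchy_Schwarz_ineq2[of "x - y" "outward_normal A x"] A.norm_outward_normal[OF x] by simp
    ultimately show "\<bar>(x - y) \<bullet> outward_normal A x\<bar> \<le> 1 / \<delta> * (norm (x - y))\<^sup>2" by linarith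
  qed
qed

section \<open>Domination of both kernels by a common weak singularity\<close>

section \<open>Size of the kernels\<close>

text \<open>With \<open>d = DIM('a)\<close>, the quadratic estimate improves the exponent from
  \<open>1 - d\<close> to \<open>2 - d = 1/2 + (1/2 - k)\<close>; the spare square root is bounded
  by \<open>sqrt R\<close>.\<close>

lemma abs_K_star_le:
  fixes x y :: "'a::euclidean_space"
  assumes dim: "DIM('a) \<ge> 2" and k: "k = DIM('a) - 1" and C: "0 \<le> C"
    and quad: "\<bar>(x - y) \<bullet> outward_normal \<Omega> x\<bar> \<le> C * (norm (x - y))\<^sup>2"
    and R: "norm (x - y) \<le> R"
  shows "\<bar>K_star \<Omega> x y\<bar> \<le>
    C * sqrt R / (DIM('a) * unit_ball_vol DIM('a)) * norm (x - y) powr (1/2 - k)"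
proof (cases "x = y")
  case False
  define \<rho> where "\<rho> = norm (x - y)"
  define D where "D = DIM('a) * unit_ball_vol (real DIM('a))"
  have \<rho>: "0 < \<rho>" "\<rho> \<le> R" using False R by (auto simp: \<rho>_def)
  have D: "0 < D" unfolding D_def by (intro mult_pos_pos) auto
  have "real k = real DIM('a) - 1" using dim k by linarith
  then have exponent: "2 - real DIM('a) = 1/2 + (1/2 - k)" by simp
  have "\<rho>\<^sup>2 / \<rho> ^ DIM('a) = \<rho> powr (2 - real DIM('a))"
    using \<rho> by (simp add: powr_diff powr_realpow)
  also have "\<dots> = \<rho> powr (1/2) * \<rho> powr (1/2 - k)"
    unfolding exponent by (rule powr_add)
  finally have p: "\<rho>\<^sup>2 / \<rho> ^ DIM('a) = sqrt \<rho> * \<rho> powr (1/2 - k)"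
    using \<rho> by (simp add: powr_half_sqrt)
  have "\<bar>K_star \<Omega> x y\<bar> = (\<bar>(x - y) \<bullet> outward_normal \<Omega> x\<bar> / \<rho> ^ DIM('a)) / D"
    using D by (simp add: K_star_def abs_mult abs_divide \<rho>_def D_def)
  also have "\<dots> \<le> (C * \<rho>\<^sup>2 / \<rho> ^ DIM('a)) / D"
    using quad \<rho> D by (intro divide_right_mono) (auto simp: \<rho>_def)
  also have "\<dots> = C * (\<rho>\<^sup>2 / \<rho> ^ DIM('a)) / D" by simp
  also have "\<dots> = (C / D) * sqrt \<rho> * \<rho> powr (1/2 - k)" unfolding p by simp
  also have "\<dots> \<le> (C / D) * sqrt R * \<rho> powr (1/2 - k)"
    using \<rho> C D by (intro mult_right_mono mult_left_mono) auto
  finally show ?thesis by (simp add: \<rho>_def D_def)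
qed (simp add: K_star_def)

text \<open>Outside the plane the exponent splits as for \<open>K_star\<close>. In the plane the
  logarithm is absorbed from both sides: \<open>ln \<rho> \<le> \<rho>\<close>, and
  \<open>- ln \<rho> = 2 * ln (1 / sqrt \<rho>) \<le> 2 / sqrt \<rho>\<close>.\<close>

lemma abs_Phi_le:
  assumes dim: "DIM('a::euclidean_space) \<ge> 2" and k: "k = DIM('a) - 1" and R: "0 < R"
  obtains K where "0 \<le> K" "\<And>x y :: 'a. norm (x - y) \<le> R \<Longrightarrow> \<bar>Phi x y\<bar> \<le> K * norm (x - y) powr (1/2 - k)"
proof (cases "DIM('a) = 2")
  case True
  then have k1: "k = 1" by (simp add: k)
  show ?thesis
  proof (rule that)
    show "0 \<le> 1 / (2 * pi) * (2 + R * sqrt R)" using R by simp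
    fix x y :: 'a assume xy: "norm (x - y) \<le> R"
    show "\<bar>Phi x y\<bar> \<le> 1 / (2 * pi) * (2 + R * sqrt R) * norm (x - y) powr (1/2 - k)"
    \<comment> \<open>On the diagonal both sides are \<open>0\<close>, since \<open>ln 0 = 0\<close>
      and \<open>powr\<close> vanishes at base \<open>0\<close>.\<close>
    proof (cases "x = y")
      case False
      define \<rho> where "\<rho> = norm (x - y)"
      have \<rho>: "0 < \<rho>" "\<rho> \<le> R" using False xy by (auto simp: \<rho>_def)
      have s: "0 < sqrt \<rho>" "sqrt \<rho> * sqrt \<rho> = \<rho>" using \<rho> by auto
      have q: "\<rho> powr (1/2 - k) = 1 / sqrt \<rho>"
        using \<rho> by (simp add: k1 powr_minus_divide powr_half_sqrt)
      have "ln \<rho> \<le> \<rho>" using \<rho> ln_bound by blast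
      also have "\<rho> = (\<rho> * sqrt \<rho>) / sqrt \<rho>" using s by simp
      also have "\<dots> \<le> (R * sqrt R) / sqrt \<rho>"
        using \<rho> by (intro divide_right_mono mult_mono) auto
      finally have 1: "ln \<rho> \<le> (R * sqrt R) / sqrt \<rho>" .
      have "- ln \<rho> = 2 * ln (1 / sqrt \<rho>)" using \<rho> by (simp add: ln_div ln_sqrt)
      also have "\<dots> \<le> 2 * (1 / sqrt \<rho>)" using s by (intro mult_left_mono ln_bound) auto
      finally have 2: "- ln \<rho> \<le> 2 / sqrt \<rho>" by simp
      have "0 \<le> (R * sqrt R) / sqrt \<rho>" "0 \<le> 2 / sqrt \<rho>" using R \<rho> by auto
      then have "\<bar>ln \<rho>\<bar> \<le> 2 / sqrt \<rho> + (R * sqrt R) / sqrt \<rho>" using 1 2 by linarith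
      also have "\<dots> = (2 + R * sqrt R) * \<rho> powr (1/2 - k)" by (simp add: q add_divide_distrib)
      finally have "1 / (2 * pi) * \<bar>ln \<rho>\<bar> \<le> 1 / (2 * pi) * ((2 + R * sqrt R) * \<rho> powr (1/2 - k))"
        by (rule mult_left_mono) simp
      then show ?thesis using True by (simp add: Phi_def abs_mult \<rho>_def)
    qed (simp add: Phi_def True)
  qed
next
  case False
  define c where "c = \<bar>1 / (real DIM('a) * (real DIM('a) - 2) * unit_ball_vol (real DIM('a)))\<bar>"
  show ?thesis
  proof (rule that)
    show "0 \<le> c * sqrt R" using R by (simp add: c_def)
    fix x y :: 'a assume xy: "norm (x - y) \<le> R"
    show "\<bar>Phi x y\<bar> \<le> c * sqrt R * norm (x - y) powr (1/2 - k)"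
    proof (cases "x = y")
      case ne: False
      define \<rho> where "\<rho> = norm (x - y)"
      have \<rho>: "0 < \<rho>" "\<rho> \<le> R" using ne xy by (auto simp: \<rho>_def)
      have "real k = real DIM('a) - 1" using dim k by linarith
      then have exponent: "2 - real DIM('a) = 1/2 + (1/2 - k)" by simp
      have "\<bar>Phi x y\<bar> = c * \<rho> powr (2 - real DIM('a))"
        using False by (simp add: Phi_def abs_mult c_def \<rho>_def)
      also have "\<dots> = c * (\<rho> powr (1/2) * \<rho> powr (1/2 - k))"
        unfolding exponent powr_add ..
      also have "\<dots> = c * sqrt \<rho> * \<rho> powr (1/2 - k)"
        using \<rho> by (simp add: powr_half_sqrt)
      also have "\<dots> \<le> c * sqrt R * \<rho> powr (1/2 - k)"
        using \<rho> by (intro mult_right_mono mult_left_mono) (auto simp: c_def)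
      finally show ?thesis by (simp add: \<rho>_def)
    qed (simp add: Phi_def False)
  qed
qed

lemma Phi_measurable: "Phi x \<in> borel_measurable (surface_measure S)"
proof -
  have [measurable]: "Phi x \<in> borel_measurable borel"
    unfolding Phi_def[abs_def] by measurable
  show ?thesis
    using measurable_restrict_space1[of "Phi x" borel borel S]
    by (simp cong: measurable_cong_sets[OF sets_surface_measure refl])
qed

lemma weak_kernel_measurable:
  "(\<lambda>y. ennreal (norm (x - y) powr a)) \<in> borel_measurable (surface_measure S)"
proof -
  have "(\<lambda>y. ennreal (norm (x - y) powr a)) \<in> borel_measurable borel" by measurable
  from measurable_restrict_space1[OF this, of S] show ?thesis
    by (simp cong: measurable_cong_sets[OF sets_surface_measure refl])
qed

section \<open>Adaptedness to the history, and the estimator for the given boundaries\<close>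

section \<open>The filtration of the chain\<close>

lemma subalgebra_history:
  assumes "\<And>l. l \<le> m \<Longrightarrow> Y l \<in> borel_measurable M"
  shows "subalgebra M (history M Y m)"
  unfolding subalgebra_def
proof
  show "space (history M Y m) = space M" by (simp add: history_def)
  show "sets (history M Y m) \<subseteq> sets M"
    unfolding history_def
    by (rule sets_image_in_sets[OF refl]) (rule measurable_restrict, use assms in auto)
qed

text \<open>Each variable is a coordinate projection of the tuple that generates the
  algebra.\<close>

lemma history_measurable:
  fixes Y :: "nat \<Rightarrow> 'w \<Rightarrow> 'a::topological_space"
  assumes "l \<le> m"
  shows "Y l \<in> borel_measurable (history M Y m)"
proof -
  have "(\<lambda>\<omega>. \<lambda>k\<in>{..m}. Y k \<omega>) \<in> history M Y m \<rightarrow>\<^sub>M (\<Pi>\<^sub>M k\<in>{..m}. borel)"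
    unfolding history_def by (rule measurable_vimage_algebra1) (auto simp: space_PiM)
  from measurable_component_singleton[THEN measurable_compose[OF this], of l]
  show ?thesis using assms by simp
qed

text \<open>The support hypotheses are the usual condition of importance sampling: the densities
  must not miss any part of the integrand. Integrability of the target is asserted as well, so that
  its integral is not merely the default value \<open>0\<close>.\<close>

theorem theorem4p1:
  fixes \<Omega> :: "nat \<Rightarrow> 'a::euclidean_space set"
    and pa h :: "nat \<Rightarrow> nat"
    and N i :: nat
    and \<sigma> :: "nat \<Rightarrow> real"
    and b \<beta> :: "nat \<Rightarrow> 'a \<Rightarrow> real"
    and x :: 'a
    and p0 p :: "'a \<Rightarrow> 'a \<Rightarrow> real"
    and M :: "'w measure"
    and Y :: "nat \<Rightarrow> 'w \<Rightarrow> 'a"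
  assumes dim: "DIM('a) \<ge> 2"
    and N: "N \<ge> 1"
    and root: "open (\<Omega> 1)" "connected (\<Omega> 1)" "bounded (\<Omega> 1)" "simply_connected (\<Omega> 1)"
      "smooth_boundary (\<Omega> 1)"
    and regions: "\<And>j. j \<in> {1..N} \<Longrightarrow> open (\<Omega> j) \<and> \<Omega> j \<noteq> {} \<and> \<Omega> j \<subseteq> \<Omega> 1"
    and tree: "\<And>j. j \<in> {2..N} \<Longrightarrow>
      pa j \<in> {1..N} \<and> (\<exists>k. (pa ^^ k) j = 1) \<and> \<Omega> j \<subseteq> \<Omega> (pa j)"
    and C2: "\<And>j. j \<in> {1..N} \<Longrightarrow> C2_boundary (\<Omega> j)"
    and disjoint: "\<And>j k. j \<in> {1..N} \<Longrightarrow> k \<in> {1..N} \<Longrightarrow> j \<noteq> k \<Longrightarrow>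
      frontier (\<Omega> j) \<inter> frontier (\<Omega> k) = {}"
    and sigma_nonneg: "\<And>j. j \<in> {1..N} \<Longrightarrow> \<sigma> j \<ge> 0"
    and sigma_nonzero: "\<sigma> 1 \<noteq> 0" "\<And>j. j \<in> {2..N} \<Longrightarrow> \<sigma> (pa j) + \<sigma> j \<noteq> 0"
    and b_lipschitz: "\<And>j. j \<in> {1..N} \<Longrightarrow> \<exists>L. L-lipschitz_on (frontier (\<Omega> j)) (b j)"
    and b_mean: "\<And>j. j \<in> {1..N} \<Longrightarrow> (LINT y|surface_measure (frontier (\<Omega> j)). b j y) = 0"
    and beta: "\<beta> = beta_fun \<sigma> pa b"
    and query: "x \<in> \<Omega> 1"
    and indices: "\<And>m. m \<le> i \<Longrightarrow> h m \<in> {1..N}"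
    and p0_density: "probability_density_on (frontier (\<Omega> (h 0))) (p0 x)"
    and p_density: "\<And>m y. m < i \<Longrightarrow> y \<in> frontier (\<Omega> (h m)) \<Longrightarrow>
      probability_density_on (frontier (\<Omega> (h (Suc m)))) (p y)"
    and p_measurable: "\<And>m. m < i \<Longrightarrow>
      case_prod p \<in> borel_measurable
        (surface_measure (frontier (\<Omega> (h m))) \<Otimes>\<^sub>M surface_measure (frontier (\<Omega> (h (Suc m)))))"
    and p0_support: "AE y in surface_measure (frontier (\<Omega> (h 0))).
      \<beta> (h 0) y \<noteq> 0 \<longrightarrow> p0 x y \<noteq> 0"
    and p_support: "\<And>m y. m < i \<Longrightarrow> y \<in> frontier (\<Omega> (h m)) \<Longrightarrow>
      AE z in surface_measure (frontier (\<Omega> (h (Suc m)))).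
        K_star (\<Omega> (h (Suc m))) z y \<noteq> 0 \<longrightarrow> p y z \<noteq> 0"
    and chain: "markov_chain_with_densities M Y (\<lambda>m. frontier (\<Omega> (h m))) i (p0 x) p"
  shows "integrable (surface_measure (frontier (\<Omega> (h i))))
           (\<lambda>y. Phi x y * K_star_iter \<Omega> h (\<beta> (h 0)) i y) \<and>
         unbiased_estimator M (\<lambda>\<omega>. Q_star \<Omega> h \<beta> p0 p x Y i \<omega> * Phi x (Y i \<omega>))
           (LINT y|surface_measure (frontier (\<Omega> (h i))).
              Phi x y * K_star_iter \<Omega> h (\<beta> (h 0)) i y)"
proof -
  let ?F = "\<lambda>m. frontier (\<Omega> (h m))" and ?S = "\<lambda>m. surface_measure (frontier (\<Omega> (h m)))"
  define k where "k = DIM('a) - 1"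
  have k: "k = DIM('a) - 1" "k \<ge> 1" using dim by (auto simp: k_def)
  have region: "compact_C2_region (\<Omega> j)" if "j \<in> {1..N}" for j
    using regions[OF that] C2[OF that] bounded_subset[OF root(3)]
    by (simp add: compact_C2_region_def compact_frontier_bounded)
  \<comment> \<open>A ball around the closed domain bounds all relevant distances by
    \<open>2 * \<rho>\<close>, the radius in every kernel estimate below.\<close>
  obtain \<rho> where \<rho>: "0 < \<rho>" "closure (\<Omega> 1) \<subseteq> ball 0 \<rho>"
    using bounded_subset_ballD[OF bounded_closure[OF root(3)], of 0] by blast
  have F_closure: "?F m \<subseteq> closure (\<Omega> 1)" if "m \<le> i" for m
    using closure_mono[of "\<Omega> (h m)" "\<Omega> 1"] regions[OF indices[OF that]] by (auto simp: frontier_def)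
  have near: "norm (u - v) < 2 * \<rho>" if "u \<in> closure (\<Omega> 1)" "v \<in> closure (\<Omega> 1)" for u v
    using norm_triangle_ineq4[of u v] subsetD[OF \<rho>(2) that(1)] subsetD[OF \<rho>(2) that(2)] by simp
  have upper: "\<exists>C. upper_regular (?F m) C" if "m \<le> i" for m
    using compact_C2_region.upper_regular_frontier[OF region[OF indices[OF that]] dim] by blast
  have finite: "finite_measure (?S m)" if "m \<le> i" for m
    using upper[OF that] finite_surface_measure bounded_subset[OF bounded_closure[OF root(3)] F_closure[OF that]]
    by blast
  \<comment> \<open>Uniformity over the closed domain matters: \<open>u\<close> is a boundary point
    in \<open>kernel\<close> and the query point at the end.\<close>
  have weak: "\<exists>K\<ge>0. \<forall>u\<in>closure (\<Omega> 1). (\<integral>\<^sup>+y. ennreal (norm (u - y) powr (1/2 - k)) \<partial>?S m) \<le> ennreal K"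
    if m: "m \<le> i" for m
  proof -
    obtain C where "upper_regular (?F m) C" using upper[OF m] by blast
    then obtain K where K: "0 \<le> K" "\<And>u. ?F m \<subseteq> ball u (2 * \<rho>) \<Longrightarrow>
        (\<integral>\<^sup>+y. ennreal (norm (u - y) powr (1/2 - k)) \<partial>?S m) \<le> ennreal K"
      using weakly_singular_integral[of "?F m" C "2 * \<rho>" k] \<rho>(1) k by auto
    have "?F m \<subseteq> ball u (2 * \<rho>)" if "u \<in> closure (\<Omega> 1)" for u
      using near[OF that] F_closure[OF m] by (auto simp: dist_norm)
    with K show ?thesis by blast
  qed
  have kernel: "\<exists>K. \<forall>z\<in>?F (Suc m). (\<integral>\<^sup>+y. ennreal \<bar>K_star (\<Omega> (h (Suc m))) z y\<bar> \<partial>?S m) \<le> ennreal K"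
    if m: "m < i" for m
  proof -
    have hm: "h m \<in> {1..N}" "h (Suc m) \<in> {1..N}" using indices m by auto
    obtain C where C: "0 \<le> C" "\<And>z y. z \<in> ?F (Suc m) \<Longrightarrow> y \<in> ?F m \<Longrightarrow>
        \<bar>(z - y) \<bullet> outward_normal (\<Omega> (h (Suc m))) z\<bar> \<le> C * (norm (z - y))\<^sup>2"
      using normal_quadratic_pair[OF region[OF hm(2)] region[OF hm(1)]] disjoint[OF hm(2,1)] by metis
    obtain K where K: "0 \<le> K" "\<And>u. u \<in> closure (\<Omega> 1) \<Longrightarrow>
        (\<integral>\<^sup>+y. ennreal (norm (u - y) powr (1/2 - k)) \<partial>?S m) \<le> ennreal K"
      using weak[of m] m by auto
    \<comment> \<open>The constant of \<open>abs_K_star_le\<close> for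
      \<open>R = 2 * \<rho>\<close>.\<close>
    define c where "c = C * sqrt (2 * \<rho>) / (DIM('a) * unit_ball_vol (real DIM('a)))"
    have c: "0 \<le> c" using C(1) \<rho>(1) by (auto simp: c_def intro!: divide_nonneg_nonneg mult_nonneg_nonneg)
    have "(\<integral>\<^sup>+y. ennreal \<bar>K_star (\<Omega> (h (Suc m))) z y\<bar> \<partial>?S m) \<le> ennreal (c * K)"
      if z: "z \<in> ?F (Suc m)" for z
    proof -
      have zc: "z \<in> closure (\<Omega> 1)" using z F_closure[of "Suc m"] m by auto
      have "(\<integral>\<^sup>+y. ennreal \<bar>K_star (\<Omega> (h (Suc m))) z y\<bar> \<partial>?S m) \<le>
          (\<integral>\<^sup>+y. ennreal c * ennreal (norm (z - y) powr (1/2 - k)) \<partial>?S m)"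
      proof (rule nn_integral_mono)
        fix y assume "y \<in> space (?S m)"
        then have y: "y \<in> ?F m" by simp
        then have "norm (z - y) \<le> 2 * \<rho>" using near[OF zc, of y] F_closure[of m] m by force
        from abs_K_star_le[OF dim k(1) C(1) C(2)[OF z y] this]
        show "ennreal \<bar>K_star (\<Omega> (h (Suc m))) z y\<bar> \<le> ennreal c * ennreal (norm (z - y) powr (1/2 - k))"
          using c by (simp add: c_def ennreal_leI flip: ennreal_mult)
      qed
      also have "\<dots> = ennreal c * (\<integral>\<^sup>+y. ennreal (norm (z - y) powr (1/2 - k)) \<partial>?S m)"
        by (rule nn_integral_cmult) (rule weak_kernel_measurable)
      also have "\<dots> \<le> ennreal c * ennreal K" by (rule mult_left_mono[OF K(2)[OF zc]]) simp
      finally show ?thesis using c K(1) by (simp add: ennreal_mult)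
    qed
    then show ?thesis by blast
  qed
  have h0: "h 0 \<in> {1..N}" using indices[of 0] by simp
  obtain l where "l-lipschitz_on (?F 0) (b (h 0))" using b_lipschitz[OF h0] by blast
  then have "continuous_on (?F 0) (b (h 0))" by (rule lipschitz_on_continuous_on)
  \<comment> \<open>Up to a constant factor \<open>\<beta> (h 0)\<close> is the Lipschitz datum, so
    it is continuous and, on the compact frontier, bounded.\<close>
  moreover have "\<exists>c. \<beta> (h 0) = (\<lambda>y. c * b (h 0) y)"
    by (rule exI[of _ "if h 0 = 1 then 2 / \<sigma> 1 else - (2 / (\<sigma> (pa (h 0)) + \<sigma> (h 0)))"])
       (auto simp: beta beta_fun_def)
  ultimately have \<beta>_cont: "continuous_on (?F 0) (\<beta> (h 0))"
    by (auto intro!: continuous_on_mult_left)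
  have \<beta>_meas: "\<beta> (h 0) \<in> borel_measurable (?S 0)"
    using borel_measurable_continuous_on_restrict[OF \<beta>_cont]
    by (simp cong: measurable_cong_sets[OF sets_surface_measure refl])
  obtain B0 where B0: "\<And>y. y \<in> ?F 0 \<Longrightarrow> \<bar>\<beta> (h 0) y\<bar> \<le> B0"
    using compact_imp_bounded[OF compact_continuous_image[OF \<beta>_cont compact_C2_region.compact[OF region[OF h0]]]]
    unfolding bounded_iff by auto
  have Y: "Y m \<in> M \<rightarrow>\<^sub>M ?S m" if "m \<le> i" for m
    using chain that by (simp add: markov_chain_with_densities_def)
  have Y_borel: "Y m \<in> borel_measurable M" if "m \<le> i" for m
    using Y[OF that] by (simp add: measurable_restrict_space2_iff cong: measurable_cong_sets[OF refl sets_surface_measure])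
  interpret M: prob_space M using chain by (simp add: markov_chain_with_densities_def)
  interpret W: weighted_markov_chain M i "history M Y" Y ?S "p0 x" "\<beta> (h 0)" p
    "\<lambda>m z y. K_star (\<Omega> (h (Suc m))) z y"
  proof (intro weighted_markov_chain.intro weighted_markov_chain_axioms.intro)
    show "prob_space M" by (rule M.prob_space_axioms)
    show "sigma_finite_measure (?S m)" if "m \<le> i" for m
      using finite[OF that] by (rule finite_measure.axioms)
    show "subalgebra M (history M Y m)" if "m \<le> i" for m
      using that Y_borel by (intro subalgebra_history) auto
    show "Y l \<in> history M Y m \<rightarrow>\<^sub>M ?S l" if lm: "l \<le> m" "m \<le> i" for l m
    proof -
      \<comment> \<open>The history is generated by Borel-valued coordinates; measurability into the
        surface also requires that the values lie on it.\<close>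
      have "Y l \<in> space (history M Y m) \<rightarrow> ?F l"
        using measurable_space[OF Y[of l]] lm by (auto simp: history_def)
      then show ?thesis using history_measurable[OF lm(1), of Y M]
        by (simp add: measurable_restrict_space2 cong: measurable_cong_sets[OF refl sets_surface_measure])
    qed
    show "\<beta> (h 0) \<in> borel_measurable (?S 0)" by (rule \<beta>_meas)
    show "p0 x \<in> borel_measurable (?S 0)" "\<And>y. y \<in> space (?S 0) \<Longrightarrow> 0 \<le> p0 x y"
      using p0_density by (auto simp: probability_density_on_def)
    show "AE y in ?S 0. \<beta> (h 0) y \<noteq> 0 \<longrightarrow> p0 x y \<noteq> 0" by (rule p0_support)
    show "distr M (?S 0) (Y 0) = density (?S 0) (\<lambda>y. ennreal (p0 x y))"
      using chain by (simp add: markov_chain_with_densities_def distributed_def)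
    show "(\<lambda>(y, z). K_star (\<Omega> (h (Suc m))) z y) \<in> borel_measurable (?S m \<Otimes>\<^sub>M ?S (Suc m))" if "m < i" for m
      using compact_C2_region.K_star_measurable[OF region[OF indices[of "Suc m"]]] that by simp
    show "(\<lambda>(y, z). p y z) \<in> borel_measurable (?S m \<Otimes>\<^sub>M ?S (Suc m))" if "m < i" for m
      using p_measurable[OF that] by simp
    show "0 \<le> p y z" if "m < i" "y \<in> space (?S m)" "z \<in> space (?S (Suc m))" for m y z
      using p_density[OF that(1), of y] that by (simp add: probability_density_on_def)
    show "(\<integral>\<^sup>+z. ennreal (p y z) \<partial>?S (Suc m)) = 1" if "m < i" "y \<in> space (?S m)" for m y
      using p_density[OF that(1), of y] that by (simp add: probability_density_on_def)
    show "AE z in ?S (Suc m). K_star (\<Omega> (h (Suc m))) z y \<noteq> 0 \<longrightarrow> p y z \<noteq> 0"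
      if "m < i" "y \<in> space (?S m)" for m y
      using p_support[OF that(1), of y] that by simp
    show "AE \<omega> in M. real_cond_exp M (history M Y m) (\<lambda>\<omega>. indicator B (Y (Suc m) \<omega>)) \<omega> =
        (LINT z:B|?S (Suc m). p (Y m \<omega>) z)" if "m < i" "B \<in> sets (?S (Suc m))" for m B
      using chain that by (simp add: markov_chain_with_densities_def)
  qed
  have iter: "K_star_iter \<Omega> h (\<beta> (h 0)) m = W.iter m" for m
    by (induction m) (auto simp: K_star_op_def fun_eq_iff)
  have weight: "Q_star \<Omega> h \<beta> p0 p x Y m \<omega> = W.weight m \<omega>" for m \<omega>
    by (induction m) auto
  have "\<exists>B. \<forall>y\<in>?F i. W.abs_iter i y \<le> ennreal B"
    using W.abs_iter_bounded[of B0 i] B0 kernel by simp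
  then obtain B where B: "\<And>y. y \<in> ?F i \<Longrightarrow> W.abs_iter i y \<le> ennreal B" by blast
  have xc: "x \<in> closure (\<Omega> 1)" using query closure_subset by blast
  obtain K where K: "0 \<le> K" "\<And>u. u \<in> closure (\<Omega> 1) \<Longrightarrow>
      (\<integral>\<^sup>+y. ennreal (norm (u - y) powr (1/2 - k)) \<partial>?S i) \<le> ennreal K"
    using weak[of i] by auto
  obtain c where c: "0 \<le> c" "\<And>u v :: 'a. norm (u - v) \<le> 2 * \<rho> \<Longrightarrow> \<bar>Phi u v\<bar> \<le> c * norm (u - v) powr (1/2 - k)"
    using abs_Phi_le[OF dim k(1), of "2 * \<rho>"] \<rho>(1) by auto
  \<comment> \<open>This finiteness is the remaining condition of
    \<open>W.expectation_weight\<close>: a bounded factor multiplies \<open>Phi x\<close>, which is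
    dominated by the weak singularity.\<close>
  have "(\<integral>\<^sup>+y. ennreal \<bar>Phi x y\<bar> * W.abs_iter i y \<partial>?S i) \<le>
      (\<integral>\<^sup>+y. ennreal (c * \<bar>B\<bar>) * ennreal (norm (x - y) powr (1/2 - k)) \<partial>?S i)"
  proof (rule nn_integral_mono)
    fix y assume "y \<in> space (?S i)"
    then have y: "y \<in> ?F i" by simp
    then have "norm (x - y) \<le> 2 * \<rho>" using near[OF xc, of y] F_closure[of i] by force
    then have "ennreal \<bar>Phi x y\<bar> \<le> ennreal (c * norm (x - y) powr (1/2 - k))"
      using c(2) by (intro ennreal_leI)
    moreover have "W.abs_iter i y \<le> ennreal \<bar>B\<bar>"
      using B[OF y] by (rule order_trans) (simp add: ennreal_leI)
    ultimately have "ennreal \<bar>Phi x y\<bar> * W.abs_iter i y \<le> ennreal (c * norm (x - y) powr (1/2 - k)) * ennreal \<bar>B\<bar>"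
      by (intro mult_mono) auto
    then show "ennreal \<bar>Phi x y\<bar> * W.abs_iter i y \<le> ennreal (c * \<bar>B\<bar>) * ennreal (norm (x - y) powr (1/2 - k))"
      using c(1) by (simp add: ennreal_mult mult_ac)
  qed
  also have "\<dots> = ennreal (c * \<bar>B\<bar>) * (\<integral>\<^sup>+y. ennreal (norm (x - y) powr (1/2 - k)) \<partial>?S i)"
    by (rule nn_integral_cmult) (rule weak_kernel_measurable)
  also have "\<dots> \<le> ennreal (c * \<bar>B\<bar>) * ennreal K"
    by (rule mult_left_mono[OF K(2)[OF xc]]) simp
  also have "\<dots> < \<infinity>" by (simp add: ennreal_mult_less_top)
  finally have fin: "(\<integral>\<^sup>+y. ennreal \<bar>Phi x y\<bar> * W.abs_iter i y \<partial>?S i) < \<infinity>" .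
  show ?thesis
    unfolding unbiased_estimator_def iter weight
    using W.integrable_weight[OF order_refl Phi_measurable fin] W.expectation_weight[OF order_refl Phi_measurable fin]
    by simp
qed

end
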